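(* Let $a(y,t)$ be a sufficiently smooth coefficient and let $T$ be the solution of $$\frac{\partial T}{\partial t}(y,t)-\Delta T(y,t)+a(y,t)T(y,t)=0,\quad y\in\Omega(t),$$ $$T(y,t)=0,\quad y\in\partial\Omega(t),\ \forall t;\qquad T(y,0)=T_0(y),\quad y\in\Omega_0.$$ If $$T_0\in L^2(\Omega_0),\qquad T_0(x)\ge0,\quad x\in\Omega_0,$$ and $$\alpha(t)\le a(y,t)\qquad\forall y\in\Omega(t),\ \forall t,$$ for some smooth $\alpha(t)$, then $$T(y,t)\ge0,\qquad y\in\Omega(t),\ t\ge0.$$
   Context: $\Omega_0\subset\mathbb{R}^n$ is a given domain (smooth open set). $\vec{V}:\mathbb{R}^n\to\mathbb{R}^n$ is a smooth vector field such that all solutions of the autonomous system $\dot Y=\vec{V}(Y)$ are defined for all $t\in\mathbb{R}$. For $t\in\mathbb{R}$, $\phi(t):\mathbb{R}^n\to\mathbb{R}^n$ is the flow map $\phi(t)x=Y(t;x)$, where $Y(\cdot;x)$ is the solution with $Y(0;x)=x$. The moving domain is $\Omega(t)=\phi(t)\Omega_0$, with boundary $\partial\Omega(t)=\phi(t)\partial\Omega_0$. *)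

theory Defs
  imports "HOL-Analysis.Analysis"
begin

text \<open>\<open>C_k k f S\<close>: \<open>f\<close> is \<open>k\<close> times continuously differentiable. The set \<open>S\<close> is
  meant to be open, since the derivatives are taken at full neighbourhoods.\<close>

primrec C_k :: "nat \<Rightarrow> ('a::euclidean_space \<Rightarrow> 'b::euclidean_space) \<Rightarrow> 'a set \<Rightarrow> bool" where
  "C_k 0 f S \<longleftrightarrow> continuous_on S f"
| "C_k (Suc k) f S \<longleftrightarrow>
     (\<forall>x\<in>S. f differentiable (at x)) \<and>
     (\<forall>v. C_k k (\<lambda>x. frechet_derivative f (at x) v) S)"

definition smooth_on :: "'a::euclidean_space set \<Rightarrow> ('a \<Rightarrow> 'b::euclidean_space) \<Rightarrow> bool" where
  "smooth_on S f \<longleftrightarrow> (\<forall>k. C_k k f S)"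

text \<open>Open set with smooth boundary: near each boundary point it is the sublevel set
  of a smooth function without critical points. Neither boundedness nor connectedness is
  required.\<close>

definition smooth_domain :: "'a::euclidean_space set \<Rightarrow> bool" where
  "smooth_domain \<Omega> \<longleftrightarrow> open \<Omega> \<and>
     (\<forall>p\<in>frontier \<Omega>. \<exists>U (\<rho>::'a \<Rightarrow> real). open U \<and> p \<in> U \<and> smooth_on U \<rho> \<and>
        (\<forall>x\<in>U. frechet_derivative \<rho> (at x) \<noteq> (\<lambda>_. 0)) \<and>
        \<Omega> \<inter> U = {x \<in> U. \<rho> x < 0})"

text \<open>\<open>\<phi> t x\<close> is the value at time \<open>t\<close> of the solution of \<open>Y' = V(Y)\<close>, \<open>Y(0) = x\<close>. Time
  ranges over all of \<open>\<real>\<close>, so for smooth \<open>V\<close> (uniqueness of solutions) such a \<open>\<phi>\<close>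
  exists if and only if all solutions are global, and it is then unique.\<close>

definition flow_of :: "('a::euclidean_space \<Rightarrow> 'a) \<Rightarrow> (real \<Rightarrow> 'a \<Rightarrow> 'a) \<Rightarrow> bool" where
  "flow_of V \<phi> \<longleftrightarrow>
     (\<forall>x. \<phi> 0 x = x \<and>
          (\<forall>t. ((\<lambda>s. \<phi> s x) has_vector_derivative V (\<phi> t x)) (at t)))"

definition moving_domain ::
  "(real \<Rightarrow> 'a \<Rightarrow> 'a) \<Rightarrow> 'a set \<Rightarrow> real \<Rightarrow> 'a set" where
  "moving_domain \<phi> \<Omega>\<^sub>0 t = \<phi> t ` \<Omega>\<^sub>0"

definition partial_deriv :: "'n \<Rightarrow> (real^'n \<Rightarrow> real) \<Rightarrow> real^'n \<Rightarrow> real" where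
  "partial_deriv i f x = frechet_derivative f (at x) (axis i 1)"

definition laplacian :: "(real^'n \<Rightarrow> real) \<Rightarrow> real^'n \<Rightarrow> real" where
  "laplacian f x = (\<Sum>i\<in>UNIV. partial_deriv i (partial_deriv i f) x)"

definition in_L2 :: "'a::euclidean_space set \<Rightarrow> ('a \<Rightarrow> real) \<Rightarrow> bool" where
  "in_L2 S f \<longleftrightarrow> f \<in> borel_measurable (lebesgue_on S) \<and>
                 integrable (lebesgue_on S) (\<lambda>x. (f x)\<^sup>2)"

text \<open>\<open>t \<mapsto> u t \<in> L\<^sup>2(D t)\<close> is continuous on \<open>[0,\<infinity>)\<close>. Since \<open>D t\<close> varies, functions at
  different times are compared in \<open>L\<^sup>2\<close> of the whole space after extension by zero.\<close>

definition continuous_L2 ::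
  "(real \<Rightarrow> 'a::euclidean_space set) \<Rightarrow> (real \<Rightarrow> 'a \<Rightarrow> real) \<Rightarrow> bool" where
  "continuous_L2 D u \<longleftrightarrow>
     (\<forall>t\<ge>0. in_L2 (D t) (u t)) \<and>
     (\<forall>s\<ge>0. ((\<lambda>t. \<integral>y. (indicator (D t) y * u t y - indicator (D s) y * u s y)\<^sup>2 \<partial>lebesgue)
               \<longlongrightarrow> 0) (at s within {0..}))"

text \<open>The solution for initial data that are merely in \<open>L\<^sup>2\<close>: because of parabolic smoothing
  the equation and the boundary condition hold in the classical pointwise sense for \<open>t > 0\<close>,
  while the initial value is attained as an element of \<open>L\<^sup>2\<close>, through continuity of
  \<open>t \<mapsto> T(\<cdot>,t)\<close> in \<open>L\<^sup>2\<close>. No regularity or boundary value is imposed at \<open>t = 0\<close>.\<close>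

definition heat_solution ::
  "(real \<Rightarrow> (real^'n) set) \<Rightarrow> (real^'n \<Rightarrow> real \<Rightarrow> real) \<Rightarrow> (real^'n \<Rightarrow> real) \<Rightarrow>
   (real^'n \<Rightarrow> real \<Rightarrow> real) \<Rightarrow> bool" where
  "heat_solution D a T\<^sub>0 T \<longleftrightarrow>
     continuous_on {(y, t). 0 < t \<and> y \<in> closure (D t)} (\<lambda>(y, t). T y t) \<and>
     (\<forall>t>0. C_k 2 (\<lambda>y. T y t) (D t)) \<and>
     (\<forall>t>0. \<forall>y\<in>D t. (\<lambda>s. T y s) differentiable (at t)) \<and>
     continuous_on {(y, t). 0 < t \<and> y \<in> D t} (\<lambda>(y, t). deriv (\<lambda>s. T y s) t) \<and>
     (\<forall>t>0. \<forall>y\<in>D t. deriv (\<lambda>s. T y s) t - laplacian (\<lambda>z. T z t) y + a y t * T y t = 0) \<and>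
     (\<forall>t>0. \<forall>y\<in>frontier (D t). T y t = 0) \<and>
     continuous_L2 D (\<lambda>t y. T y t) \<and>
     (AE y in lebesgue_on (D 0). T y 0 = T\<^sub>0 y)"

end

theory Submission
  imports Defs
begin

text \<open>Fix a final time \<open>\<tau>\<close> and a constant \<open>K \<ge> 0\<close> with \<open>- K \<le> \<alpha>\<close> on \<open>[0, \<tau>]\<close>, and put
  \<open>w = - exp (- K t) T\<close>. Where \<open>w > 0\<close> it satisfies \<open>w\<^sub>t \<le> \<Delta> w\<close>. For \<open>\<epsilon> > 0\<close> let \<open>\<beta>\<close> be convex,
  nondecreasing, \<open>C\<^sup>2\<close>, zero on \<open>x \<le> \<epsilon>\<close> and at most \<open>x\<^sup>2\<close> for \<open>x \<ge> 0\<close>. Since \<open>w = 0\<close> on the moving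
  boundary, the set \<open>w \<ge> \<epsilon>\<close> stays away from it, so \<open>u = \<beta>(w)\<close>, extended by zero, is a classical
  subsolution of the heat equation on all of \<open>\<real>\<^sup>n\<close> for \<open>t > 0\<close>; neither the geometry of the
  domain nor its regularity enters any more. Testing with
  \<open>\<psi>(y) = (max 0 (1 - \<bar>y\<bar>\<^sup>2 / R\<^sup>2))\<^sup>3\<close>, for which \<open>\<Delta> \<psi> \<le> 24 / R\<^sup>2\<close>, bounds the time derivative
  of \<open>\<integral> u \<psi>\<close> by \<open>24 M / R\<^sup>2\<close>, where \<open>M\<close> bounds the squared \<open>L\<^sup>2\<close> distance of \<open>T(\<cdot>, t)\<close> from
  \<open>T(\<cdot>, 0)\<close>. This distance dominates \<open>\<integral> u\<close> because \<open>T(\<cdot>, 0) \<ge> 0\<close>, and it tends to 0 as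
  \<open>t \<rightarrow> 0\<close>. Letting \<open>R \<rightarrow> \<infinity>\<close> gives \<open>u = 0\<close>, that is \<open>w \<le> \<epsilon>\<close>.\<close>

section \<open>Flows of vector fields\<close>

text \<open>The squared distance weighted by \<open>exp (- 2 * L * t)\<close> is nonincreasing, by
  Cauchy-Schwarz. The Lipschitz bound is asked for along the two curves only, so that a locally
  Lipschitz field suffices.\<close>

lemma gronwall_diff:
  fixes x y :: "real \<Rightarrow> 'a::euclidean_space"
  assumes x: "\<And>t. 0 \<le> t \<Longrightarrow> t \<le> \<tau> \<Longrightarrow> (x has_vector_derivative W (x t)) (at t)"
    and y: "\<And>t. 0 \<le> t \<Longrightarrow> t \<le> \<tau> \<Longrightarrow> (y has_vector_derivative W (y t)) (at t)"
    and L: "\<And>t. 0 \<le> t \<Longrightarrow> t \<le> \<tau> \<Longrightarrow> norm (W (x t) - W (y t)) \<le> L * norm (x t - y t)"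
    and "0 \<le> \<tau>"
  shows "norm (x \<tau> - y \<tau>) \<le> exp (L * \<tau>) * norm (x 0 - y 0)"
proof -
  define d where "d t = x t - y t" for t
  define q where "q t = exp (- 2 * L * t) * (d t \<bullet> d t)" for t
  have "q \<tau> \<le> q 0"
  proof (rule DERIV_nonpos_imp_nonincreasing[OF \<open>0 \<le> \<tau>\<close>])
    fix t assume t: "0 \<le> t" "t \<le> \<tau>"
    define e where "e = W (x t) - W (y t)"
    have "(d has_vector_derivative e) (at t)"
      unfolding d_def[abs_def] e_def by (intro has_vector_derivative_diff x y t)
    then have D: "(d has_derivative (\<lambda>h. h *\<^sub>R e)) (at t)"
      by (simp add: has_vector_derivative_def)
    have "((\<lambda>t. d t \<bullet> d t) has_derivative (\<lambda>h. d t \<bullet> (h *\<^sub>R e) + (h *\<^sub>R e) \<bullet> d t)) (at t)"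
      by (rule has_derivative_inner[OF D D])
    then have "((\<lambda>t. d t \<bullet> d t) has_real_derivative 2 * (d t \<bullet> e)) (at t)"
      by (rule has_derivative_imp_has_field_derivative) (simp add: inner_commute)
    then have "(q has_real_derivative exp (- 2 * L * t) * (2 * (d t \<bullet> e) - 2 * L * (d t \<bullet> d t))) (at t)"
      unfolding q_def[abs_def] by (auto intro!: derivative_eq_intros simp: algebra_simps)
    moreover have "d t \<bullet> e \<le> L * (d t \<bullet> d t)"
    proof -
      have "d t \<bullet> e \<le> norm (d t) * norm e" by (rule norm_cauchy_schwarz)
      also have "\<dots> \<le> norm (d t) * (L * norm (d t))"
        using L[OF t] by (intro mult_left_mono) (auto simp: d_def e_def)
      finally show ?thesis by (simp add: dot_square_norm power2_eq_square ac_simps)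
    qed
    ultimately show "\<exists>z. (q has_real_derivative z) (at t) \<and> z \<le> 0"
      by (intro exI[of _ "exp (- 2 * L * t) * (2 * (d t \<bullet> e) - 2 * L * (d t \<bullet> d t))"])
        (auto simp: mult_le_0_iff)
  qed
  then have "(exp (L * \<tau>))\<^sup>2 * q \<tau> \<le> (exp (L * \<tau>))\<^sup>2 * q 0"
    by (rule mult_left_mono) simp
  then have "(norm (d \<tau>))\<^sup>2 \<le> (exp (L * \<tau>) * norm (d 0))\<^sup>2"
    by (simp add: q_def power_mult_distrib power2_norm_eq_inner exp_minus
        flip: exp_double) (simp add: field_simps exp_minus)
  then show ?thesis
    unfolding d_def by (rule power2_le_imp_le) simp
qed

text \<open>\<open>C_k\<close> speaks of derivatives in fixed directions. Their continuity along the
  basis vectors bounds the operator norm on the compact ball, and convexity of the ball gives the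
  mean value inequality.\<close>

lemma C_1_lipschitz_on_cball:
  fixes V :: "'a::euclidean_space \<Rightarrow> 'b::euclidean_space"
  assumes "C_k (Suc 0) V UNIV"
  obtains L where "0 \<le> L"
    "\<And>x y. norm x \<le> R \<Longrightarrow> norm y \<le> R \<Longrightarrow> norm (V x - V y) \<le> L * norm (x - y)"
proof -
  let ?D = "\<lambda>x. frechet_derivative V (at x)"
  have diff: "(V has_derivative ?D x) (at x)" for x
    using assms by (simp add: frechet_derivative_works)
  have cont: "continuous_on UNIV (\<lambda>x. ?D x v)" for v
    using assms by simp
  have "continuous_on (cball 0 R) (\<lambda>x. \<Sum>b\<in>Basis. norm (?D x b))"
    by (intro continuous_intros continuous_on_subset[OF cont]) auto
  then have "bounded ((\<lambda>x. \<Sum>b\<in>Basis. norm (?D x b)) ` cball 0 R)"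
    by (intro compact_imp_bounded compact_continuous_image) auto
  then obtain L where L: "0 < L" "\<And>x. norm x \<le> R \<Longrightarrow> norm (\<Sum>b\<in>Basis. norm (?D x b)) \<le> L"
    unfolding bounded_pos by auto
  have on: "onorm (?D x) \<le> L" if "norm x \<le> R" for x
  proof (rule onorm_le)
    fix v
    have "norm (?D x v) = norm (?D x (\<Sum>b\<in>Basis. (v \<bullet> b) *\<^sub>R b))"
      by (simp add: euclidean_representation)
    also have "\<dots> = norm (\<Sum>b\<in>Basis. (v \<bullet> b) *\<^sub>R ?D x b)"
      using has_derivative_linear[OF diff[of x]] by (simp add: linear_sum linear_cmul)
    also have "\<dots> \<le> (\<Sum>b\<in>Basis. norm v * norm (?D x b))"
      by (intro sum_norm_le) (auto intro!: mult_right_mono Basis_le_norm)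
    also have "\<dots> = norm v * (\<Sum>b\<in>Basis. norm (?D x b))"
      by (simp add: sum_distrib_left)
    also have "\<dots> \<le> norm v * L"
      using L(2)[OF that] by (intro mult_left_mono) auto
    finally show "norm (?D x v) \<le> L * norm v" by (simp add: ac_simps)
  qed
  have "norm (V x - V y) \<le> L * norm (x - y)" if "norm x \<le> R" "norm y \<le> R" for x y
    by (rule differentiable_bound[of "cball 0 R" V ?D])
      (use that on diff in \<open>auto intro: has_derivative_at_withinI\<close>)
  with L(1) show ?thesis by (intro that[of L]) auto
qed

text \<open>Reversing time reduces statements about negative times to statements about nonnegative
  times.\<close>

lemma flow_of_reverse:
  assumes "flow_of V \<phi>"
  shows "flow_of (\<lambda>x. - V x) (\<lambda>t. \<phi> (- t))"
  unfolding flow_of_def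
proof (intro allI conjI)
  fix x t
  show "\<phi> (- 0) x = x" using assms by (simp add: flow_of_def)
  have "((\<lambda>s. \<phi> s x) has_vector_derivative V (\<phi> (- t) x)) (at (- t))"
    using assms by (simp add: flow_of_def)
  then have "((\<lambda>s. \<phi> s x) \<circ> uminus has_vector_derivative (- 1) *\<^sub>R V (\<phi> (- t) x)) (at t)"
    by (intro vector_diff_chain_at) (auto intro!: derivative_eq_intros)
  then show "((\<lambda>s. \<phi> (- s) x) has_vector_derivative - V (\<phi> (- t) x)) (at t)"
    by (simp add: o_def)
qed

lemma C_1_uminus:
  assumes "C_k (Suc 0) V UNIV"
  shows "C_k (Suc 0) (\<lambda>x. - V x) UNIV"
proof -
  have V: "(V has_derivative frechet_derivative V (at x)) (at x)" for x
    using assms by (simp add: frechet_derivative_works)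
  have "frechet_derivative (\<lambda>x. - V x) (at x) = (\<lambda>v. - frechet_derivative V (at x) v)" for x
    using has_derivative_minus[OF V] by (rule frechet_derivative_at[symmetric])
  with assms show ?thesis by (auto intro!: continuous_intros)
qed

lemma curve_bounded:
  fixes z :: "real \<Rightarrow> 'a::real_normed_vector"
  assumes "\<And>t. (z has_vector_derivative z' t) (at t)"
  obtains R where "\<And>t. t \<in> {0..\<tau>} \<Longrightarrow> norm (z t) \<le> R"
proof -
  have "continuous_on {0..\<tau>} z"
    using assms by (auto intro!: continuous_at_imp_continuous_on has_vector_derivative_continuous)
  then have "bounded (z ` {0..\<tau>})"
    by (intro compact_imp_bounded compact_continuous_image) auto
  then show ?thesis using that unfolding bounded_iff by blast
qed

text \<open>On \<open>{0..\<tau>}\<close> both curves stay in one ball, where \<open>V\<close> is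
  Lipschitz, so \<open>gronwall_diff\<close> applies.\<close>

lemma ode_unique:
  fixes V :: "'a::euclidean_space \<Rightarrow> 'a"
  assumes V: "C_k (Suc 0) V UNIV" and "0 \<le> \<tau>"
    and x: "\<And>t. (x has_vector_derivative V (x t)) (at t)"
    and y: "\<And>t. (y has_vector_derivative V (y t)) (at t)"
    and "x 0 = y 0"
  shows "x \<tau> = y \<tau>"
proof -
  obtain R1 R2 where R: "\<And>t. t \<in> {0..\<tau>} \<Longrightarrow> norm (x t) \<le> R1"
    "\<And>t. t \<in> {0..\<tau>} \<Longrightarrow> norm (y t) \<le> R2"
    using curve_bounded[OF x] curve_bounded[OF y] by metis
  obtain L where L: "\<And>p q. norm p \<le> max R1 R2 \<Longrightarrow> norm q \<le> max R1 R2 \<Longrightarrow>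
      norm (V p - V q) \<le> L * norm (p - q)"
    using C_1_lipschitz_on_cball[OF V] by metis
  have "norm (x \<tau> - y \<tau>) \<le> exp (L * \<tau>) * norm (x 0 - y 0)"
    by (rule gronwall_diff[where W = V, OF x y L \<open>0 \<le> \<tau>\<close>]) (use R in \<open>auto simp: le_max_iff_disj\<close>)
  with \<open>x 0 = y 0\<close> show ?thesis by simp
qed

text \<open>As functions of \<open>s\<close> both sides solve the same autonomous system with the
  same value at \<open>s = 0\<close>. Negative \<open>s\<close> is reached through the reversed
  flow.\<close>

lemma flow_of_add:
  assumes V: "C_k (Suc 0) V UNIV" and \<phi>: "flow_of V \<phi>"
  shows "\<phi> s (\<phi> t x) = \<phi> (s + t) x"
proof -
  have pos: "\<psi> s (\<psi> t x) = \<psi> (s + t) x"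
    if W: "C_k (Suc 0) W UNIV" and \<psi>: "flow_of W \<psi>" and "0 \<le> s" for W \<psi> s t
  proof (rule ode_unique[OF W \<open>0 \<le> s\<close>])
    show "((\<lambda>s. \<psi> s (\<psi> t x)) has_vector_derivative W (\<psi> r (\<psi> t x))) (at r)" for r
      using \<psi> by (simp add: flow_of_def)
    show "((\<lambda>s. \<psi> (s + t) x) has_vector_derivative W (\<psi> (r + t) x)) (at r)" for r
    proof -
      have "((\<lambda>s. \<psi> s x) \<circ> (\<lambda>s. s + t) has_vector_derivative 1 *\<^sub>R W (\<psi> (r + t) x)) (at r)"
        using \<psi> by (intro vector_diff_chain_at)
          (auto simp: flow_of_def intro!: derivative_eq_intros)
      then show ?thesis by (simp add: o_def)
    qed
    show "\<psi> 0 (\<psi> t x) = \<psi> (0 + t) x" using \<psi> by (simp add: flow_of_def)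
  qed
  show ?thesis
  proof (cases "0 \<le> s")
    case True
    then show ?thesis using pos[OF V \<phi>] by simp
  next
    case False
    then show ?thesis
      using pos[OF C_1_uminus[OF V] flow_of_reverse[OF \<phi>], of "- s" "- t"]
      by (simp add: add.commute)
  qed
qed

text \<open>A bootstrap argument: as long as the trajectory from \<open>y\<close> stays within
  distance 1 of the one from \<open>x\<close>, a fixed Lipschitz constant of \<open>V\<close>
  applies, and the resulting Gronwall bound keeps it strictly inside this tube.\<close>

lemma flow_of_lipschitz_initial:
  assumes V: "C_k (Suc 0) V UNIV" and \<phi>: "flow_of V \<phi>" and "0 \<le> \<tau>"
  obtains C \<delta> where "0 < C" "0 < \<delta>"
    "\<And>y t. norm (y - x) < \<delta> \<Longrightarrow> 0 \<le> t \<Longrightarrow> t \<le> \<tau> \<Longrightarrow> norm (\<phi> t y - \<phi> t x) \<le> C * norm (y - x)"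
proof -
  have der: "((\<lambda>t. \<phi> t y) has_vector_derivative V (\<phi> t y)) (at t)" for y t
    using \<phi> by (simp add: flow_of_def)
  obtain R where R: "\<And>t. t \<in> {0..\<tau>} \<Longrightarrow> norm (\<phi> t x) \<le> R"
    using curve_bounded[OF der[of x]] by metis
  \<comment> \<open>The radius \<open>R + 1\<close> covers the tube of width 1 around the trajectory
    of \<open>x\<close>.\<close>
  obtain L where L: "0 \<le> L" "\<And>p q. norm p \<le> R + 1 \<Longrightarrow> norm q \<le> R + 1 \<Longrightarrow>
      norm (V p - V q) \<le> L * norm (p - q)"
    using C_1_lipschitz_on_cball[OF V] by metis
  have zero: "\<phi> 0 y = y" for y using \<phi> by (simp add: flow_of_def)
  have gr: "norm (\<phi> t y - \<phi> t x) \<le> exp (L * \<tau>) * norm (y - x)"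
    if t: "0 \<le> t" "t \<le> \<tau>" and near: "\<And>s. 0 \<le> s \<Longrightarrow> s \<le> t \<Longrightarrow> norm (\<phi> s y - \<phi> s x) \<le> 1" for t y
  proof -
    have "norm (\<phi> t y - \<phi> t x) \<le> exp (L * t) * norm (\<phi> 0 y - \<phi> 0 x)"
    proof (rule gronwall_diff[where W = V, OF der der _ t(1)])
      fix s assume s: "0 \<le> s" "s \<le> t"
      have "norm (\<phi> s x) \<le> R" using R s t by auto
      moreover have "norm (\<phi> s y) \<le> norm (\<phi> s x) + norm (\<phi> s y - \<phi> s x)"
        by (metis norm_triangle_sub)
      ultimately show "norm (V (\<phi> s y) - V (\<phi> s x)) \<le> L * norm (\<phi> s y - \<phi> s x)"
        using near[OF s] by (intro L(2)) auto
    qed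
    also have "\<dots> \<le> exp (L * \<tau>) * norm (y - x)"
      using L t by (auto simp: zero intro!: mult_right_mono mult_left_mono)
    finally show ?thesis .
  qed
  \<comment> \<open>With this \<open>\<delta>\<close> the Gronwall bound
    \<open>exp (L * \<tau>) * norm (y - x)\<close> is below the tube radius 1.\<close>
  define \<delta> where "\<delta> = exp (- (L * \<tau>))"
  have main: "norm (\<phi> t y - \<phi> t x) \<le> 1" if y: "norm (y - x) < \<delta>" and t: "0 \<le> t" "t \<le> \<tau>" for t y
  proof (rule ccontr)
    assume far: "\<not> norm (\<phi> t y - \<phi> t x) \<le> 1"
    \<comment> \<open>first time at which the two trajectories are at distance 1\<close>
    define E where "E = {s \<in> {0..t}. norm (\<phi> s y - \<phi> s x) \<in> {1..}}"
    have cont: "continuous_on {0..t} (\<lambda>s. norm (\<phi> s y - \<phi> s x))"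
      by (intro continuous_intros continuous_at_imp_continuous_on ballI
          has_vector_derivative_continuous[OF der])
    have "E = {0..t} \<inter> (\<lambda>s. norm (\<phi> s y - \<phi> s x)) -` {1..}" by (auto simp: E_def)
    then have "closed E"
      using continuous_closed_preimage[OF cont, of "{1..}"] by simp
    moreover have "bounded E" by (rule bounded_subset[of "{0..t}"]) (auto simp: E_def)
    moreover have "t \<in> E" using far t by (auto simp: E_def)
    ultimately obtain s where s: "s \<in> E" "\<And>r. r \<in> E \<Longrightarrow> s \<le> r"
      using compact_attains_inf[of E] compact_eq_bounded_closed by blast
    have before: "norm (\<phi> r y - \<phi> r x) < 1" if "0 \<le> r" "r < s" for r
      using s(2)[of r] s(1) that by (force simp: E_def)
    have "0 \<le> s" "s \<le> \<tau>" using s t by (auto simp: E_def)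
    have lt: "exp (L * \<tau>) * norm (y - x) < 1"
      using y by (simp add: \<delta>_def exp_minus field_simps)
    have "s \<noteq> 0"
    proof
      assume "s = 0"
      then have "1 \<le> norm (y - x)" using s(1) by (simp add: E_def zero)
      moreover have "\<delta> \<le> 1" using L \<open>0 \<le> \<tau>\<close> by (simp add: \<delta>_def)
      ultimately show False using y by simp
    qed
    \<comment> \<open>Gronwall holds at every time before \<open>s\<close>; the left limit carries
      the bound to \<open>s\<close>, where the distance is at least 1.\<close>
    have "((\<lambda>r. norm (\<phi> r y - \<phi> r x)) \<longlongrightarrow> norm (\<phi> s y - \<phi> s x)) (at_left s)"
    proof -
      have "isCont (\<lambda>r. norm (\<phi> r y - \<phi> r x)) s"
        by (intro continuous_intros has_vector_derivative_continuous[OF der])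
      then show ?thesis
        by (auto simp: isCont_def intro: tendsto_mono[OF at_le])
    qed
    moreover have "eventually (\<lambda>r. norm (\<phi> r y - \<phi> r x) \<le> exp (L * \<tau>) * norm (y - x)) (at_left s)"
      unfolding eventually_at_left_field
    proof (intro exI[of _ 0] conjI allI impI)
      show "0 < s" using \<open>0 \<le> s\<close> \<open>s \<noteq> 0\<close> by simp
      fix r assume "0 < r" "r < s"
      then show "norm (\<phi> r y - \<phi> r x) \<le> exp (L * \<tau>) * norm (y - x)"
        using \<open>s \<le> \<tau>\<close> by (intro gr) (auto intro!: less_imp_le before)
    qed
    ultimately have "norm (\<phi> s y - \<phi> s x) \<le> exp (L * \<tau>) * norm (y - x)"
      by (rule tendsto_upperbound) simp
    with lt s(1) show False by (simp add: E_def)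
  qed
  show ?thesis
    by (rule that[of "exp (L * \<tau>)" \<delta>]) (auto simp: \<delta>_def intro!: gr main)
qed

text \<open>Near a given point, \<open>\<phi> s y\<close> is compared with
  \<open>\<phi> s x\<close>: the difference is Lipschitz in \<open>y\<close> uniformly in
  \<open>s\<close>, and the trajectory of \<open>x\<close> is continuous.\<close>

lemma flow_of_continuous:
  fixes V :: "'a::euclidean_space \<Rightarrow> 'a"
  assumes V: "C_k (Suc 0) V UNIV" and \<phi>: "flow_of V \<phi>"
  shows "continuous_on UNIV (\<lambda>(x, t). \<phi> t x)"
proof (intro continuous_at_imp_continuous_on ballI)
  fix p :: "'a \<times> real"
  obtain x t where p: "p = (x, t)" by (cases p)
  define \<tau> where "\<tau> = \<bar>t\<bar> + 1"
  have \<tau>: "0 \<le> \<tau>" by (simp add: \<tau>_def)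
  obtain C1 \<delta>1 where 1: "0 < C1" "0 < \<delta>1"
    "\<And>y t. norm (y - x) < \<delta>1 \<Longrightarrow> 0 \<le> t \<Longrightarrow> t \<le> \<tau> \<Longrightarrow> norm (\<phi> t y - \<phi> t x) \<le> C1 * norm (y - x)"
    using flow_of_lipschitz_initial[OF V \<phi> \<tau>] by metis
  obtain C2 \<delta>2 where 2: "0 < C2" "0 < \<delta>2"
    "\<And>y t. norm (y - x) < \<delta>2 \<Longrightarrow> 0 \<le> t \<Longrightarrow> t \<le> \<tau> \<Longrightarrow>
       norm (\<phi> (- t) y - \<phi> (- t) x) \<le> C2 * norm (y - x)"
    using flow_of_lipschitz_initial[OF C_1_uminus[OF V] flow_of_reverse[OF \<phi>] \<tau>] by metis
  have B: "norm (\<phi> s y - \<phi> s x) \<le> (C1 + C2) * norm (y - x)"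
    if "norm (y - x) < min \<delta>1 \<delta>2" "\<bar>s\<bar> \<le> \<tau>" for y s
  proof (cases "0 \<le> s")
    case True
    then have "norm (\<phi> s y - \<phi> s x) \<le> C1 * norm (y - x)" using 1(3)[of y s] that by simp
    also have "\<dots> \<le> (C1 + C2) * norm (y - x)" using 2 by (intro mult_right_mono) auto
    finally show ?thesis .
  next
    case False
    then have "norm (\<phi> s y - \<phi> s x) \<le> C2 * norm (y - x)" using 2(3)[of y "- s"] that by simp
    also have "\<dots> \<le> (C1 + C2) * norm (y - x)" using 1 by (intro mult_right_mono) auto
    finally show ?thesis .
  qed
  have "((\<lambda>q. \<phi> (snd q) (fst q)) \<longlongrightarrow> \<phi> t x) (at p)"
  proof (rule Lim_transform2)
    have "isCont (\<lambda>s. \<phi> s x) t"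
      using \<phi> by (auto simp: flow_of_def intro: has_vector_derivative_continuous)
    moreover have "(snd \<longlongrightarrow> t) (at p)" by (simp add: p) (auto intro!: tendsto_eq_intros)
    ultimately show "((\<lambda>q. \<phi> (snd q) x) \<longlongrightarrow> \<phi> t x) (at p)"
      by (rule isCont_tendsto_compose)
    have "((\<lambda>q. (C1 + C2) * norm (fst q - x)) \<longlongrightarrow> (C1 + C2) * norm (x - x)) (at p)"
      unfolding p by (intro tendsto_intros tendsto_eq_intros) auto
    then have "((\<lambda>q. (C1 + C2) * norm (fst q - x)) \<longlongrightarrow> 0) (at p)" by simp
    moreover have "eventually (\<lambda>q. norm (\<phi> (snd q) x - \<phi> (snd q) (fst q)) \<le>
        (C1 + C2) * norm (fst q - x)) (at p)"
    proof -
      have "eventually (\<lambda>q. dist (fst q) x < min \<delta>1 \<delta>2) (at p)"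
        by (rule tendstoD) (use 1 2 in \<open>auto simp: p intro!: tendsto_eq_intros\<close>)
      moreover have "eventually (\<lambda>q. dist (snd q) t < 1) (at p)"
        by (rule tendstoD) (auto simp: p intro!: tendsto_eq_intros)
      ultimately show ?thesis
      proof eventually_elim
        case (elim q)
        then have "\<bar>snd q\<bar> \<le> \<tau>" by (auto simp: \<tau>_def dist_real_def)
        with B[of "fst q" "snd q"] elim show ?case
          by (simp add: dist_norm norm_minus_commute)
      qed
    qed
    ultimately show "((\<lambda>q. \<phi> (snd q) x - \<phi> (snd q) (fst q)) \<longlongrightarrow> 0) (at p)"
      by (rule Lim_null_comparison[rotated])
  qed
  then show "isCont (\<lambda>(x, t). \<phi> t x) p"
    unfolding isCont_def p case_prod_unfold by simp
qed

text \<open>The space-time domain is the preimage of \<open>\<Omega>\<close> under the continuous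
  map taking \<open>(y, t)\<close> to \<open>\<phi> (- t) y\<close>, hence open. Its closure is
  mapped into \<open>closure \<Omega>\<close>, and \<open>\<phi> t\<close> carries that back into
  the closure of the slice at time \<open>t\<close>.\<close>

lemma
  fixes V :: "'a::euclidean_space \<Rightarrow> 'a"
  assumes V: "C_k (Suc 0) V UNIV" and \<phi>: "flow_of V \<phi>" and "open \<Omega>"
  shows open_space_time_moving_domain: "open {(y, t). y \<in> moving_domain \<phi> \<Omega> t}"
    and closure_space_time_moving_domain:
      "(y, t) \<in> closure {(y, t). y \<in> moving_domain \<phi> \<Omega> t} \<Longrightarrow> y \<in> closure (moving_domain \<phi> \<Omega> t)"
    and moving_domain_0: "moving_domain \<phi> \<Omega> 0 = \<Omega>"
proof -
  define \<Psi> where "\<Psi> = (\<lambda>(y, t). \<phi> (- t) y)"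
  have "continuous_on UNIV ((\<lambda>(x, t). \<phi> t x) \<circ> (\<lambda>(y, t). (y, - t)))"
    by (intro continuous_on_compose continuous_on_subset[OF flow_of_continuous[OF V \<phi>]])
      (auto simp: case_prod_beta intro!: continuous_intros)
  then have cont: "continuous_on UNIV \<Psi>"
    by (simp add: \<Psi>_def o_def case_prod_beta)
  have zero: "\<phi> 0 x = x" for x using \<phi> by (simp add: flow_of_def)
  have inv: "\<phi> t (\<phi> (- t) x) = x" "\<phi> (- t) (\<phi> t x) = x" for t x
    by (simp_all add: flow_of_add[OF V \<phi>] zero)
  have eq: "{(y, t). y \<in> moving_domain \<phi> \<Omega> t} = \<Psi> -` \<Omega>"
    unfolding moving_domain_def \<Psi>_def by (auto simp: inv) (metis inv(1) imageI)
  show "open {(y, t). y \<in> moving_domain \<phi> \<Omega> t}"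
    unfolding eq using cont \<open>open \<Omega>\<close> by (simp add: open_vimage)
  show "moving_domain \<phi> \<Omega> 0 = \<Omega>"
    by (simp add: moving_domain_def zero)
  assume "(y, t) \<in> closure {(y, t). y \<in> moving_domain \<phi> \<Omega> t}"
  moreover have "closed (\<Psi> -` closure \<Omega>)"
    using cont by (simp add: closed_vimage)
  then have "closure (\<Psi> -` \<Omega>) \<subseteq> \<Psi> -` closure \<Omega>"
    by (intro closure_minimal) (use closure_subset in auto)
  ultimately have "\<phi> (- t) y \<in> closure \<Omega>"
    unfolding eq by (auto simp: \<Psi>_def)
  then have "\<phi> t (\<phi> (- t) y) \<in> \<phi> t ` closure \<Omega>" by simp
  also have "\<phi> t ` closure \<Omega> \<subseteq> closure (\<phi> t ` \<Omega>)"
  proof (rule image_closure_subset)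
    have "continuous_on UNIV ((\<lambda>(x, t). \<phi> t x) \<circ> (\<lambda>y. (y, t)))"
      by (intro continuous_on_compose continuous_on_subset[OF flow_of_continuous[OF V \<phi>]])
        (auto intro!: continuous_intros)
    then have "continuous_on UNIV (\<phi> t)" by (simp add: o_def)
    then show "continuous_on (closure \<Omega>) (\<phi> t)" by (rule continuous_on_subset) simp
  qed (auto intro: closure_subset[THEN subsetD])
  finally show "y \<in> closure (moving_domain \<phi> \<Omega> t)"
    by (simp add: inv moving_domain_def)
qed

section \<open>Truncation and extension by zero\<close>

text \<open>On \<open>G \<inter> N\<close> the function \<open>f\<close> agrees with zero, so the
  two pieces glue over the open cover by \<open>G\<close> and \<open>N\<close>.\<close>

lemma continuous_on_extend_zero:
  fixes f :: "'a::topological_space \<Rightarrow> 'b::{topological_space, zero}"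
  assumes "open G" "open N" "H \<subseteq> G \<union> N" "continuous_on G f"
    and "\<And>p. p \<in> G \<Longrightarrow> p \<in> N \<Longrightarrow> f p = 0"
  shows "continuous_on H (\<lambda>p. if p \<in> G then f p else 0)"
proof -
  let ?g = "\<lambda>p. if p \<in> G then f p else 0"
  have "continuous_on G ?g" using assms(4) by (rule continuous_on_eq) simp
  moreover have "continuous_on N ?g"
    by (rule continuous_on_eq[of _ "\<lambda>_. 0"]) (auto simp: assms(5))
  ultimately have "continuous_on (G \<union> N) ?g"
    using assms(1,2) by (intro continuous_on_open_Un)
  then show ?thesis by (rule continuous_on_subset) fact
qed

text \<open>A point outside \<open>G\<close> lies in \<open>N\<close>, where the extension is zero
  near it. The direction \<open>e\<close> is arbitrary so that the lemma serves, in space-time, for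
  the time derivative as well as for the partial derivatives.\<close>

lemma line_derivative_extend_zero:
  fixes f :: "'a::real_normed_vector \<Rightarrow> real"
  assumes "open G" "open N" "p \<in> G \<union> N"
    and "p \<in> G \<Longrightarrow> ((\<lambda>r. f (p + r *\<^sub>R e)) has_real_derivative f' p) (at 0)"
    and "\<And>p. p \<in> G \<Longrightarrow> p \<in> N \<Longrightarrow> f p = 0"
  shows "((\<lambda>r. if p + r *\<^sub>R e \<in> G then f (p + r *\<^sub>R e) else 0) has_real_derivative
           (if p \<in> G then f' p else 0)) (at 0)"
proof -
  have pre: "open ((\<lambda>r::real. p + r *\<^sub>R e) -` S)" if "open S" for S
    using that by (intro open_vimage continuous_intros)
  show ?thesis
  proof (cases "p \<in> G")
    case True
    then show ?thesis
      by (auto intro!: has_field_derivative_transform_within_open[OF assms(4) pre[OF \<open>open G\<close>]])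
  next
    case False
    then have "p \<in> N" using assms(3) by simp
    have "((\<lambda>r. 0) has_real_derivative 0) (at 0)" by simp
    then have "((\<lambda>r. if p + r *\<^sub>R e \<in> G then f (p + r *\<^sub>R e) else 0) has_real_derivative 0) (at 0)"
      by (rule has_field_derivative_transform_within_open[OF _ pre[OF \<open>open N\<close>]])
        (use assms(5) \<open>p \<in> N\<close> in auto)
    with False show ?thesis by simp
  qed
qed

text \<open>At 0 the difference quotient of the composite is dominated by that of \<open>f\<close>,
  which tends to \<open>f' 0 = 0\<close>.\<close>

lemma DERIV_max_0:
  fixes f :: "real \<Rightarrow> real"
  assumes "\<And>x. 0 \<le> x \<Longrightarrow> (f has_real_derivative f' x) (at x)" and "f' 0 = 0"
  shows "((\<lambda>x. f (max 0 x)) has_real_derivative f' (max 0 x)) (at x)"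
proof (cases "x = 0")
  case True
  have "((\<lambda>h. (f (0 + h) - f 0) / h) \<longlongrightarrow> 0) (at 0)"
    using assms(1)[of 0] assms(2) by (simp add: DERIV_def)
  then have "((\<lambda>h. (f (max 0 (0 + h)) - f (max 0 0)) / h) \<longlongrightarrow> 0) (at 0)"
    by (rule tendsto_0_le[where K = 1]) (auto simp: max_def divide_le_0_iff intro!: always_eventually)
  then show ?thesis using True assms(2) by (simp add: DERIV_def)
next
  case False
  show ?thesis
  proof (cases "0 < x")
    case True
    then have "(f has_real_derivative f' (max 0 x)) (at x)" using assms(1)[of x] by simp
    then show ?thesis
      by (rule has_field_derivative_transform_within_open[of _ _ _ "{0<..}"]) (use True in auto)
  next
    case neg: False
    have "((\<lambda>_. f 0) has_real_derivative f' (max 0 x)) (at x)" using neg assms(2) by simp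
    then show ?thesis
      by (rule has_field_derivative_transform_within_open[of _ _ _ "{..<0}"])
        (use neg False in auto)
  qed
qed

text \<open>With \<open>s = max 0 (x - \<epsilon>)\<close> the function \<open>trunc \<epsilon> x\<close> is \<open>s\<^sup>3 / (1 + s)\<close>. The cube
  makes it twice continuously differentiable at \<open>\<epsilon>\<close>; dividing by \<open>1 + s\<close> keeps it convex and
  reduces the growth to quadratic, so that it is controlled by the \<open>L\<^sup>2\<close> norm.\<close>

definition trunc :: "real \<Rightarrow> real \<Rightarrow> real" where
  "trunc \<epsilon> x = (let s = max 0 (x - \<epsilon>) in s\<^sup>2 - s + 1 - 1 / (1 + s))"

definition trunc' :: "real \<Rightarrow> real \<Rightarrow> real" where
  "trunc' \<epsilon> x = (let s = max 0 (x - \<epsilon>) in 2 * s - 1 + 1 / (1 + s)\<^sup>2)"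

definition trunc'' :: "real \<Rightarrow> real \<Rightarrow> real" where
  "trunc'' \<epsilon> x = (let s = max 0 (x - \<epsilon>) in 2 - 2 / (1 + s) ^ 3)"

text \<open>The defining form of \<open>trunc\<close> results from polynomial division and is easy
  to differentiate; the quotient shows sign and growth.\<close>

lemma trunc_eq: "trunc \<epsilon> x = (max 0 (x - \<epsilon>)) ^ 3 / (1 + max 0 (x - \<epsilon>))"
proof -
  have "s\<^sup>2 - s + 1 - 1 / (1 + s) = s ^ 3 / (1 + s)" if "0 \<le> s" for s :: real
    using that by (simp add: field_simps power2_eq_square power3_eq_cube)
  then show ?thesis by (simp add: trunc_def Let_def)
qed

lemma DERIV_trunc: "(trunc \<epsilon> has_real_derivative trunc' \<epsilon> x) (at x)"
proof -
  have "((\<lambda>x. (\<lambda>s. s\<^sup>2 - s + 1 - 1 / (1 + s)) (max 0 x)) has_real_derivative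
      (\<lambda>s. 2 * s - 1 + 1 / (1 + s)\<^sup>2) (max 0 (x - \<epsilon>))) (at (x + - \<epsilon>))"
    unfolding diff_conv_add_uminus[of x]
    by (rule DERIV_max_0)
      (auto intro!: derivative_eq_intros simp: field_simps power2_eq_square)
  then show ?thesis
    unfolding DERIV_shift trunc_def[abs_def] trunc'_def Let_def by simp
qed

lemma DERIV_trunc': "(trunc' \<epsilon> has_real_derivative trunc'' \<epsilon> x) (at x)"
proof -
  have "((\<lambda>x. (\<lambda>s. 2 * s - 1 + 1 / (1 + s)\<^sup>2) (max 0 x)) has_real_derivative
      (\<lambda>s. 2 - 2 / (1 + s) ^ 3) (max 0 (x - \<epsilon>))) (at (x + - \<epsilon>))"
    unfolding diff_conv_add_uminus[of x]
  proof (rule DERIV_max_0)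
    fix s :: real assume "0 \<le> s"
    then show "((\<lambda>s. 2 * s - 1 + 1 / (1 + s)\<^sup>2) has_real_derivative 2 - 2 / (1 + s) ^ 3) (at s)"
      by (auto intro!: derivative_eq_intros)
        (simp add: divide_simps, simp add: algebra_simps power2_eq_square power3_eq_cube
          power4_eq_xxxx)?
  qed simp
  then show ?thesis
    unfolding DERIV_shift trunc'_def[abs_def] trunc''_def Let_def by simp
qed

lemma continuous_on_trunc: "continuous_on S (trunc \<epsilon>)"
  and continuous_on_trunc': "continuous_on S (trunc' \<epsilon>)"
  by (auto intro!: continuous_at_imp_continuous_on DERIV_isCont[OF DERIV_trunc]
      DERIV_isCont[OF DERIV_trunc'])

lemma continuous_on_trunc'': "continuous_on S (trunc'' \<epsilon>)"
  unfolding trunc''_def Let_def by (intro continuous_intros) auto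

lemma trunc_eq_0:
  assumes "x \<le> \<epsilon>"
  shows "trunc \<epsilon> x = 0" "trunc' \<epsilon> x = 0" "trunc'' \<epsilon> x = 0"
  using assms by (auto simp: trunc_def trunc'_def trunc''_def max_def)

lemma trunc_nonneg: "0 \<le> trunc \<epsilon> x"
  by (simp add: trunc_eq)

lemma trunc''_nonneg: "0 \<le> trunc'' \<epsilon> x"
  by (simp add: trunc''_def Let_def divide_simps)

lemma trunc'_nonneg: "0 \<le> trunc' \<epsilon> x"
proof (cases "x \<le> \<epsilon>")
  case False
  have "trunc' \<epsilon> \<epsilon> \<le> trunc' \<epsilon> x"
    by (rule DERIV_nonneg_imp_nondecreasing)
      (use False in \<open>auto intro!: exI[of _ "trunc'' \<epsilon> _"] DERIV_trunc' trunc''_nonneg\<close>)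
  then show ?thesis by (simp add: trunc_eq_0)
qed (simp add: trunc_eq_0)

lemma trunc_pos:
  assumes "\<epsilon> < x"
  shows "0 < trunc \<epsilon> x"
  using assms by (simp add: trunc_eq)

lemma trunc_le_square:
  assumes "0 \<le> \<epsilon>"
  shows "trunc \<epsilon> x \<le> (max 0 x)\<^sup>2"
proof -
  define s where "s = max 0 (x - \<epsilon>)"
  have "0 \<le> s" "s \<le> max 0 x" using assms by (auto simp: s_def)
  have "s ^ 3 / (1 + s) \<le> s\<^sup>2"
    using \<open>0 \<le> s\<close> by (simp add: divide_simps power2_eq_square power3_eq_cube algebra_simps)
  also have "\<dots> \<le> (max 0 x)\<^sup>2"
    using \<open>0 \<le> s\<close> \<open>s \<le> max 0 x\<close> by (intro power_mono)
  finally show ?thesis by (simp add: trunc_eq s_def)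
qed

section \<open>Integration by parts against a cutoff\<close>

text \<open>No divergence theorem is needed: by translation invariance the integral of
  \<open>g (x + h e)\<close> does not depend on \<open>h\<close>, so its derivative at \<open>h = 0\<close> vanishes.\<close>

lemma integral_directional_derivative_eq_0:
  fixes g g' :: "'a::euclidean_space \<Rightarrow> real"
  assumes g: "continuous_on UNIV g" and g': "continuous_on UNIV g'"
    and der: "\<And>x. ((\<lambda>h. g (x + h *\<^sub>R e)) has_real_derivative g' x) (at 0)"
    and supp: "\<And>x. x \<notin> cbox a b \<Longrightarrow> g x = 0"
  shows "integral (cbox a b) g' = 0"
proof -
  \<comment> \<open>The complement of the box is open, so \<open>g\<close> vanishes along a short
    segment through \<open>x\<close>.\<close>
  have supp': "g' x = 0" if "x \<notin> cbox a b" for x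
  proof -
    have "open ((\<lambda>h::real. x + h *\<^sub>R e) -` (- cbox a b))"
      by (intro open_vimage continuous_intros open_Compl closed_cbox)
    then have "((\<lambda>h. 0) has_real_derivative g' x) (at 0)"
      by (rule has_field_derivative_transform_within_open[OF der])
        (use that in \<open>auto simp: supp\<close>)
    then show ?thesis by (rule DERIV_unique) simp
  qed
  \<comment> \<open>The box from \<open>c\<close> to \<open>d\<close> contains the support of
    \<open>g\<close> shifted by any \<open>h *\<^sub>R e\<close> with
    \<open>\<bar>h\<bar> \<le> 1\<close>.\<close>
  define c where "c = a - norm e *\<^sub>R One"
  define d where "d = b + norm e *\<^sub>R One"
  have shifted: "cbox (a - h *\<^sub>R e) (b - h *\<^sub>R e) \<subseteq> cbox c d" if "\<bar>h\<bar> \<le> 1" for h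
  proof -
    have "\<bar>h * (e \<bullet> i)\<bar> \<le> norm e" if "i \<in> Basis" for i
      using mult_mono[OF \<open>\<bar>h\<bar> \<le> 1\<close> Basis_le_norm[OF that, of e]] by (simp add: abs_mult)
    then show ?thesis
      unfolding subset_box c_def d_def
      by (intro impI ballI) (fastforce simp: inner_diff_left inner_add_left abs_le_iff)
  qed
  define I where "I h = integral (cbox c d) (\<lambda>x. g (x + h *\<^sub>R e))" for h
  have const: "I h = integral (cbox a b) g" if "\<bar>h\<bar> < 1" for h
  proof -
    have "(g has_integral integral (cbox a b) g) (cbox a b)"
      by (intro integrable_integral integrable_continuous continuous_on_subset[OF g]) simp
    then have "((\<lambda>x. g (x + h *\<^sub>R e)) has_integral integral (cbox a b) g)
        (cbox (a - h *\<^sub>R e) (b - h *\<^sub>R e))"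
      using has_integral_shift_cbox_iff[of g "h *\<^sub>R e" _ "a - h *\<^sub>R e" "b - h *\<^sub>R e"]
      by (simp add: o_def add.commute)
    then have "((\<lambda>x. g (x + h *\<^sub>R e)) has_integral integral (cbox a b) g) (cbox c d)"
      by (rule has_integral_on_superset)
        (use that in \<open>auto intro!: supp shifted[THEN subsetD]
          simp: mem_box inner_diff_left inner_add_left algebra_simps\<close>)
    then show ?thesis by (simp add: I_def integral_unique)
  qed
  \<comment> \<open>Differentiation under the integral sign; \<open>I\<close> is also constant near
    0, and the two derivatives must agree.\<close>
  have "(I has_field_derivative integral (cbox c d) (\<lambda>x. g' (x + 0 *\<^sub>R e))) (at 0 within UNIV)"
    unfolding I_def[abs_def]
  proof (rule leibniz_rule_field_derivative)
    fix h x
    have "((\<lambda>k. g (x + (k + h) *\<^sub>R e)) has_real_derivative g' (x + h *\<^sub>R e)) (at 0)"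
      using der[of "x + h *\<^sub>R e"] by (simp add: algebra_simps)
    then show "((\<lambda>h. g (x + h *\<^sub>R e)) has_real_derivative g' (x + h *\<^sub>R e)) (at h within UNIV)"
      using DERIV_shift[of "\<lambda>h. g (x + h *\<^sub>R e)" _ 0 h] by simp
    show "(\<lambda>x. g (x + h *\<^sub>R e)) integrable_on cbox c d"
      by (intro integrable_continuous continuous_on_compose2[OF g] continuous_intros) simp
  next
    show "continuous_on (UNIV \<times> cbox c d) (\<lambda>(h, x). g' (x + h *\<^sub>R e))"
      unfolding case_prod_unfold
      by (intro continuous_on_compose2[OF g'] continuous_intros) simp
  qed auto
  moreover have "(I has_field_derivative 0) (at 0)"
  proof -
    have "((\<lambda>_. integral (cbox a b) g) has_field_derivative 0) (at (0::real))" by simp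
    then show ?thesis
      by (rule has_field_derivative_transform_within_open[of _ _ _ "{-1<..<1}"])
        (auto simp: const)
  qed
  ultimately have zero: "integral (cbox c d) g' = 0"
    using DERIV_unique by fastforce
  have "(g' has_integral integral (cbox a b) g') (cbox a b)"
    by (intro integrable_integral integrable_continuous continuous_on_subset[OF g']) simp
  then have "(g' has_integral integral (cbox a b) g') (cbox c d)"
    by (rule has_integral_on_superset) (use supp' shifted[of 0] in auto)
  with zero show ?thesis by (simp add: integral_unique)
qed

text \<open>The preceding lemma is applied to \<open>u' x * \<psi> x - u x * \<psi>' x\<close>: in
  its derivative the products \<open>u' x * \<psi>' x\<close> cancel.\<close>

lemma integral_by_parts_twice:
  fixes u u' u'' \<psi> \<psi>' \<psi>'' :: "'a::euclidean_space \<Rightarrow> real"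
  assumes cont: "continuous_on UNIV u" "continuous_on UNIV u'" "continuous_on UNIV u''"
      "continuous_on UNIV \<psi>" "continuous_on UNIV \<psi>'" "continuous_on UNIV \<psi>''"
    and u: "\<And>x. ((\<lambda>h. u (x + h *\<^sub>R e)) has_real_derivative u' x) (at 0)"
      "\<And>x. ((\<lambda>h. u' (x + h *\<^sub>R e)) has_real_derivative u'' x) (at 0)"
    and \<psi>: "\<And>x. ((\<lambda>h. \<psi> (x + h *\<^sub>R e)) has_real_derivative \<psi>' x) (at 0)"
      "\<And>x. ((\<lambda>h. \<psi>' (x + h *\<^sub>R e)) has_real_derivative \<psi>'' x) (at 0)"
    and supp: "\<And>x. x \<notin> cbox a b \<Longrightarrow> \<psi> x = 0" "\<And>x. x \<notin> cbox a b \<Longrightarrow> \<psi>' x = 0"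
  shows "integral (cbox a b) (\<lambda>x. u'' x * \<psi> x) = integral (cbox a b) (\<lambda>x. u x * \<psi>'' x)"
proof -
  have "integral (cbox a b) (\<lambda>x. u'' x * \<psi> x - u x * \<psi>'' x) = 0"
  proof (rule integral_directional_derivative_eq_0)
    show "((\<lambda>h. u' (x + h *\<^sub>R e) * \<psi> (x + h *\<^sub>R e) - u (x + h *\<^sub>R e) * \<psi>' (x + h *\<^sub>R e))
        has_real_derivative u'' x * \<psi> x - u x * \<psi>'' x) (at 0)" for x
      by (auto intro!: derivative_eq_intros u \<psi>)
  qed (auto intro!: continuous_intros cont simp: supp)
  moreover have "(\<lambda>x. u'' x * \<psi> x) integrable_on cbox a b" "(\<lambda>x. u x * \<psi>'' x) integrable_on cbox a b"
    by (intro integrable_continuous continuous_intros continuous_on_subset[OF cont(1)]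
        continuous_on_subset[OF cont(3)] continuous_on_subset[OF cont(4)]
        continuous_on_subset[OF cont(6)]; simp)+
  ultimately show ?thesis by (simp add: integral_diff)
qed

section \<open>The radial cutoff and its derivatives along lines\<close>

text \<open>The cube makes the function twice continuously differentiable across the sphere of
  radius \<open>R\<close>, where the maximum switches; near the centre it is a polynomial in
  \<open>y \<bullet> y\<close>.\<close>

definition cutoff :: "real \<Rightarrow> 'a::real_inner \<Rightarrow> real" where
  "cutoff R y = (max 0 (1 - (y \<bullet> y) / R\<^sup>2)) ^ 3"

definition cutoff' :: "real \<Rightarrow> 'a::real_inner \<Rightarrow> 'a \<Rightarrow> real" where
  "cutoff' R e y = 3 * (max 0 (1 - (y \<bullet> y) / R\<^sup>2))\<^sup>2 * (- 2 * (y \<bullet> e) / R\<^sup>2)"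

definition cutoff'' :: "real \<Rightarrow> 'a::real_inner \<Rightarrow> 'a \<Rightarrow> real" where
  "cutoff'' R e y = 6 * max 0 (1 - (y \<bullet> y) / R\<^sup>2) * (2 * (y \<bullet> e) / R\<^sup>2)\<^sup>2
     - 3 * (max 0 (1 - (y \<bullet> y) / R\<^sup>2))\<^sup>2 * (2 * (e \<bullet> e) / R\<^sup>2)"

lemma DERIV_max_0_power3: "((\<lambda>x. (max 0 x) ^ 3) has_real_derivative 3 * (max 0 x)\<^sup>2) (at x)"
  by (rule DERIV_max_0[of "\<lambda>x. x ^ 3" "\<lambda>x. 3 * x\<^sup>2"]) (auto intro!: derivative_eq_intros)

lemma DERIV_max_0_power2: "((\<lambda>x. (max 0 x)\<^sup>2) has_real_derivative 2 * max 0 x) (at (x::real))"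
  by (rule DERIV_max_0[of "\<lambda>x. x\<^sup>2" "\<lambda>x. 2 * x"]) (auto intro!: derivative_eq_intros)

lemma line_derivative_inner_self:
  "((\<lambda>h. 1 - ((y + h *\<^sub>R e) \<bullet> (y + h *\<^sub>R e)) / R\<^sup>2) has_real_derivative - 2 * (y \<bullet> e) / R\<^sup>2) (at 0)"
proof -
  have "(y + h *\<^sub>R e) \<bullet> (y + h *\<^sub>R e) = y \<bullet> y + h * (2 * (y \<bullet> e)) + h\<^sup>2 * (e \<bullet> e)" for h
    by (simp add: inner_add_left inner_add_right inner_commute algebra_simps power2_eq_square)
  then have "((\<lambda>h. (y + h *\<^sub>R e) \<bullet> (y + h *\<^sub>R e)) has_real_derivative 2 * (y \<bullet> e)) (at 0)"
    by (auto intro!: derivative_eq_intros)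
  from DERIV_diff[OF DERIV_const DERIV_cdivide[OF this]] show ?thesis by simp
qed

lemma line_derivative_cutoff:
  "((\<lambda>h. cutoff R (y + h *\<^sub>R e)) has_real_derivative cutoff' R e y) (at 0)"
  unfolding cutoff_def cutoff'_def
  using DERIV_chain2[OF DERIV_max_0_power3 line_derivative_inner_self[of y e R]] by simp

lemma line_derivative_cutoff':
  "((\<lambda>h. cutoff' R e (y + h *\<^sub>R e)) has_real_derivative cutoff'' R e y) (at 0)"
proof -
  have "((\<lambda>h. (max 0 (1 - ((y + h *\<^sub>R e) \<bullet> (y + h *\<^sub>R e)) / R\<^sup>2))\<^sup>2) has_real_derivative
      2 * max 0 (1 - (y \<bullet> y) / R\<^sup>2) * (- 2 * (y \<bullet> e) / R\<^sup>2)) (at 0)"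
    using DERIV_chain2[OF DERIV_max_0_power2 line_derivative_inner_self[of y e R]] by simp
  moreover have "((\<lambda>h. - 2 * ((y + h *\<^sub>R e) \<bullet> e) / R\<^sup>2) has_real_derivative
      - 2 * (e \<bullet> e) / R\<^sup>2) (at 0)"
    by (rule DERIV_cdivide) (auto intro!: derivative_eq_intros simp: inner_add_left)
  ultimately have "((\<lambda>h. (max 0 (1 - ((y + h *\<^sub>R e) \<bullet> (y + h *\<^sub>R e)) / R\<^sup>2))\<^sup>2 *
      (- 2 * ((y + h *\<^sub>R e) \<bullet> e) / R\<^sup>2)) has_real_derivative
      2 * max 0 (1 - (y \<bullet> y) / R\<^sup>2) * (- 2 * (y \<bullet> e) / R\<^sup>2) *
        (- 2 * ((y + 0 *\<^sub>R e) \<bullet> e) / R\<^sup>2) +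
      - 2 * (e \<bullet> e) / R\<^sup>2 * (max 0 (1 - ((y + 0 *\<^sub>R e) \<bullet> (y + 0 *\<^sub>R e)) / R\<^sup>2))\<^sup>2) (at 0)"
    by (rule DERIV_mult)
  then have "((\<lambda>h. 3 * ((max 0 (1 - ((y + h *\<^sub>R e) \<bullet> (y + h *\<^sub>R e)) / R\<^sup>2))\<^sup>2 *
      (- 2 * ((y + h *\<^sub>R e) \<bullet> e) / R\<^sup>2))) has_real_derivative
      3 * (2 * max 0 (1 - (y \<bullet> y) / R\<^sup>2) * (- 2 * (y \<bullet> e) / R\<^sup>2) *
        (- 2 * ((y + 0 *\<^sub>R e) \<bullet> e) / R\<^sup>2) +
      - 2 * (e \<bullet> e) / R\<^sup>2 * (max 0 (1 - ((y + 0 *\<^sub>R e) \<bullet> (y + 0 *\<^sub>R e)) / R\<^sup>2))\<^sup>2)) (at 0)"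
    by (rule DERIV_cmult)
  moreover have "3 * (2 * max 0 (1 - (y \<bullet> y) / R\<^sup>2) * (- 2 * (y \<bullet> e) / R\<^sup>2) *
        (- 2 * ((y + 0 *\<^sub>R e) \<bullet> e) / R\<^sup>2) +
      - 2 * (e \<bullet> e) / R\<^sup>2 * (max 0 (1 - ((y + 0 *\<^sub>R e) \<bullet> (y + 0 *\<^sub>R e)) / R\<^sup>2))\<^sup>2) = cutoff'' R e y"
    by (simp add: cutoff''_def power2_eq_square algebra_simps)
  ultimately show ?thesis
    unfolding cutoff'_def by (simp only: mult.assoc)
qed

lemma continuous_on_cutoff:
  "continuous_on S (cutoff R)" "continuous_on S (cutoff' R e)" "continuous_on S (cutoff'' R e)"
  unfolding cutoff_def[abs_def] cutoff'_def[abs_def] cutoff''_def[abs_def]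
  \<comment> \<open>For \<open>R = 0\<close> division by zero yields 0 and all three functions are
    constant; otherwise the denominators do not vanish.\<close>
  by - (cases "R = 0"; auto intro!: continuous_intros)+

lemma cutoff_bounds: "0 \<le> cutoff R y" "cutoff R y \<le> 1"
  by (auto simp: cutoff_def intro!: power_le_one)

text \<open>The box circumscribes the ball of radius \<open>R\<close>, outside of which the cutoff
  vanishes.\<close>

lemma inner_ge_outside_cbox:
  fixes y :: "'a::euclidean_space"
  assumes "0 < R" "y \<notin> cbox (- R *\<^sub>R One) (R *\<^sub>R One)"
  shows "R\<^sup>2 \<le> y \<bullet> y"
proof -
  obtain b where b: "b \<in> Basis" "R < \<bar>y \<bullet> b\<bar>"
    using assms(2) by (force simp: mem_box)
  then have "R < norm y" using Basis_le_norm[of b y] by simp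
  then have "R\<^sup>2 \<le> (norm y)\<^sup>2" using assms(1) by (intro power_mono) auto
  then show ?thesis by (simp add: power2_norm_eq_inner)
qed

lemma cutoff_outside_cbox:
  fixes y :: "'a::euclidean_space"
  assumes "0 < R" "y \<notin> cbox (- R *\<^sub>R One) (R *\<^sub>R One)"
  shows "cutoff R y = 0" "cutoff' R e y = 0"
  using inner_ge_outside_cbox[OF assms] assms(1)
  by (auto simp: cutoff_def cutoff'_def max_def field_simps)

text \<open>The base of the cube is at least 3 / 4 in this region; the cruder bound 1 / 2 already
  yields 1 / 8.\<close>

lemma cutoff_ge:
  assumes "2 * norm y \<le> R" "0 < R"
  shows "1 / 8 \<le> cutoff R y"
proof -
  have "(2 * norm y)\<^sup>2 \<le> R\<^sup>2" using assms by (intro power_mono) auto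
  then have "4 * (y \<bullet> y) \<le> R\<^sup>2"
    by (simp add: power_mult_distrib power2_norm_eq_inner)
  then have "2 * (y \<bullet> y) \<le> R\<^sup>2" using inner_ge_zero[of y] by linarith
  then have "(y \<bullet> y) / R\<^sup>2 \<le> 1 / 2" using assms(2) by (simp add: field_simps)
  then have "1 / 2 \<le> max 0 (1 - (y \<bullet> y) / R\<^sup>2)" by linarith
  then have "(1 / 2) ^ 3 \<le> cutoff R y" unfolding cutoff_def by (rule power_mono) simp
  then show ?thesis by (simp add: power_divide)
qed

text \<open>The terms with \<open>e \<bullet> e\<close> are nonpositive and dropped. The others add
  up to \<open>24 * q * (y \<bullet> y) / R ^ 4\<close>, where \<open>q \<le> 1\<close>, and
  \<open>q = 0\<close> once \<open>y \<bullet> y\<close> exceeds \<open>R\<^sup>2\<close>. Against a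
  nonnegative function an upper bound is all that is required.\<close>

lemma laplacian_cutoff_le:
  fixes y :: "real^'n"
  assumes "0 < R"
  shows "(\<Sum>i\<in>UNIV. cutoff'' R (axis i 1) y) \<le> 24 / R\<^sup>2"
proof -
  define q where "q = max 0 (1 - (y \<bullet> y) / R\<^sup>2)"
  have yy: "y \<bullet> y = (\<Sum>i\<in>UNIV. (y \<bullet> axis i 1)\<^sup>2)"
    by (simp add: inner_axis) (simp add: inner_vec_def power2_eq_square)
  have "(\<Sum>i\<in>UNIV. cutoff'' R (axis i 1) y) \<le> (\<Sum>i\<in>UNIV. 24 * q * (y \<bullet> axis i 1)\<^sup>2 / R ^ 4)"
  proof (rule sum_mono)
    fix i :: 'n
    have "0 \<le> 3 * q\<^sup>2 * (2 * (axis i 1 \<bullet> (axis i 1 :: real^'n)) / R\<^sup>2)" by simp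
    moreover have "6 * q * (2 * (y \<bullet> axis i 1) / R\<^sup>2)\<^sup>2 = 24 * q * (y \<bullet> axis i 1)\<^sup>2 / R ^ 4"
      by (simp add: power_divide power_mult_distrib flip: power_mult)
    ultimately show "cutoff'' R (axis i 1) y \<le> 24 * q * (y \<bullet> axis i 1)\<^sup>2 / R ^ 4"
      unfolding cutoff''_def q_def[symmetric] by linarith
  qed
  also have "\<dots> = 24 * q * (y \<bullet> y) / R ^ 4"
    unfolding yy by (simp add: sum_distrib_left sum_divide_distrib)
  also have "\<dots> \<le> 24 / R\<^sup>2"
  proof (cases "y \<bullet> y \<le> R\<^sup>2")
    case True
    have "q \<le> 1" "0 \<le> q" using assms by (auto simp: q_def)
    then have "q * (y \<bullet> y) \<le> 1 * R\<^sup>2" using True by (intro mult_mono) auto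
    then have "24 * q * (y \<bullet> y) / R ^ 4 \<le> 24 * R\<^sup>2 / R ^ 4"
      by (intro divide_right_mono) auto
    also have "\<dots> = 24 / R\<^sup>2" using assms by (simp add: field_simps flip: power_add)
    finally show ?thesis .
  next
    case False
    then have "q = 0" using assms by (auto simp: q_def max_def field_simps)
    then show ?thesis by simp
  qed
  finally show ?thesis .
qed

section \<open>Subsolutions of the heat equation on the whole space\<close>

text \<open>The mass of \<open>u\<close> weighted by \<open>cutoff R\<close> tends to 0 as time
  does, because \<open>m\<close> does, and grows at a rate of at most
  \<open>24 / R\<^sup>2 * M\<close>. Derivatives are supplied as functions along coordinate lines,
  the form in which they are obtained for an extension by zero.\<close>

lemma heat_subsolution_eq_0:
  fixes u ut :: "real^'n \<Rightarrow> real \<Rightarrow> real" and ui uii :: "'n \<Rightarrow> real^'n \<Rightarrow> real \<Rightarrow> real"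
  assumes cont: "continuous_on (UNIV \<times> {0<..}) (\<lambda>(y, t). u y t)"
      "continuous_on (UNIV \<times> {0<..}) (\<lambda>(y, t). ut y t)"
      "\<And>i t. 0 < t \<Longrightarrow> continuous_on UNIV (\<lambda>y. ui i y t)"
      "\<And>i t. 0 < t \<Longrightarrow> continuous_on UNIV (\<lambda>y. uii i y t)"
    and der: "\<And>y t. 0 < t \<Longrightarrow> ((\<lambda>s. u y s) has_real_derivative ut y t) (at t)"
      "\<And>i y t. 0 < t \<Longrightarrow> ((\<lambda>h. u (y + h *\<^sub>R axis i 1) t) has_real_derivative ui i y t) (at 0)"
      "\<And>i y t. 0 < t \<Longrightarrow> ((\<lambda>h. ui i (y + h *\<^sub>R axis i 1) t) has_real_derivative uii i y t) (at 0)"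
    and sub: "\<And>y t. 0 < t \<Longrightarrow> t \<le> \<tau> \<Longrightarrow> ut y t \<le> (\<Sum>i\<in>UNIV. uii i y t)"
    and nonneg: "\<And>y t. 0 < t \<Longrightarrow> 0 \<le> u y t"
    and m: "\<And>t a b. 0 < t \<Longrightarrow> t \<le> \<tau> \<Longrightarrow> integral (cbox a b) (\<lambda>y. u y t) \<le> m t"
      "\<And>t. 0 < t \<Longrightarrow> t \<le> \<tau> \<Longrightarrow> m t \<le> M" "(m \<longlongrightarrow> 0) (at_right 0)"
    and "0 < \<tau>"
  shows "u y \<tau> = 0"
proof -
  have u_slice: "continuous_on S (\<lambda>y. u y t)" if "0 < t" for t S
    by (rule continuous_on_compose2[OF cont(1), where f = "\<lambda>y. (y, t)", simplified])
      (use that in \<open>auto intro!: continuous_intros\<close>)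
  have ut_slice: "continuous_on S (\<lambda>y. ut y t)" if "0 < t" for t S
    by (rule continuous_on_compose2[OF cont(2), where f = "\<lambda>y. (y, t)", simplified])
      (use that in \<open>auto intro!: continuous_intros\<close>)
  define Q :: "real \<Rightarrow> (real^'n) set" where "Q R = cbox (- R *\<^sub>R One) (R *\<^sub>R One)" for R
  define F where "F R s = integral (Q R) (\<lambda>y. u y s * cutoff R y)" for R s
  have F_le: "F R \<tau> \<le> \<tau> * (24 / R\<^sup>2 * M)" if R: "0 < R" for R
  proof -
    \<comment> \<open>\<open>K\<close> bounds the growth rate: the bound on the Laplacian of the
      cutoff times the bound \<open>M\<close> on the mass.\<close>
    define K where "K = 24 / R\<^sup>2 * M"
    have F_deriv: "(F R has_real_derivative integral (Q R) (\<lambda>y. ut y s * cutoff R y)) (at s)"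
      if s: "0 < s" for s
    proof -
      have "(F R has_real_derivative integral (Q R) (\<lambda>y. ut y s * cutoff R y)) (at s within {0<..})"
        unfolding F_def[abs_def] Q_def
      proof (rule leibniz_rule_field_derivative)
        fix s y assume "s \<in> {0::real<..}"
        then show "((\<lambda>s. u y s * cutoff R y) has_real_derivative ut y s * cutoff R y)
            (at s within {0<..})"
          by (intro DERIV_cmult_right has_field_derivative_at_within[OF der(1)]) simp
      next
        show "(\<lambda>y. u y s * cutoff R y) integrable_on cbox (- R *\<^sub>R One) (R *\<^sub>R One)"
          if "s \<in> {0<..}" for s
          using that by (intro integrable_continuous continuous_intros u_slice continuous_on_cutoff) simp
        have "continuous_on ({0<..} \<times> UNIV) (\<lambda>p. (\<lambda>(y, t). ut y t) (snd p, fst p))"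
          by (rule continuous_on_compose2[OF cont(2)]) (auto intro!: continuous_intros)
        then have ut': "continuous_on ({0<..} \<times> UNIV) (\<lambda>p. ut (snd p) (fst p))"
          by simp
        show "continuous_on ({0<..} \<times> cbox (- R *\<^sub>R One) (R *\<^sub>R One))
            (\<lambda>(s, y). ut y s * cutoff R y)"
          unfolding case_prod_unfold
          by (intro continuous_on_mult continuous_on_subset[OF ut']
              continuous_on_compose2[OF continuous_on_cutoff(1)[of UNIV]] continuous_on_snd
              continuous_on_id) auto
      qed (use s in auto)
      moreover have "at s within {0<..} = at s" using s by (intro at_within_open) auto
      ultimately show ?thesis by (simp only:)
    qed
    have deriv_le: "integral (Q R) (\<lambda>y. ut y s * cutoff R y) \<le> K" if s: "0 < s" "s \<le> \<tau>" for s
    proof -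
      have int: "(\<lambda>y. f y * g y) integrable_on Q R"
        if "continuous_on UNIV f" "continuous_on UNIV g" for f g :: "real^'n \<Rightarrow> real"
        unfolding Q_def
        by (intro integrable_continuous continuous_intros)
          (rule continuous_on_subset[OF that(1)] continuous_on_subset[OF that(2)], simp)+
      have "integral (Q R) (\<lambda>y. ut y s * cutoff R y)
          \<le> integral (Q R) (\<lambda>y. \<Sum>i\<in>UNIV. uii i y s * cutoff R y)"
      proof (rule integral_le)
        show "(\<lambda>y. \<Sum>i\<in>UNIV. uii i y s * cutoff R y) integrable_on Q R"
          by (intro integrable_sum int cont(4) s continuous_on_cutoff) simp
        show "ut y s * cutoff R y \<le> (\<Sum>i\<in>UNIV. uii i y s * cutoff R y)" for y
          unfolding sum_distrib_right[symmetric]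
          by (intro mult_right_mono sub s cutoff_bounds)
      qed (intro int ut_slice s continuous_on_cutoff)
      also have "\<dots> = (\<Sum>i\<in>UNIV. integral (Q R) (\<lambda>y. uii i y s * cutoff R y))"
        by (intro integral_sum int cont(4) s continuous_on_cutoff) simp
      \<comment> \<open>Both derivatives move from \<open>u\<close> onto the compactly supported
        cutoff, one coordinate direction at a time.\<close>
      also have "\<dots> = (\<Sum>i\<in>UNIV. integral (Q R) (\<lambda>y. u y s * cutoff'' R (axis i 1) y))"
      proof (rule sum.cong[OF refl])
        fix i
        show "integral (Q R) (\<lambda>y. uii i y s * cutoff R y)
            = integral (Q R) (\<lambda>y. u y s * cutoff'' R (axis i 1) y)"
          unfolding Q_def
          by (rule integral_by_parts_twice[where e = "axis i 1" and u' = "\<lambda>y. ui i y s"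
                and \<psi>' = "cutoff' R (axis i 1)"])
            (intro u_slice cont(3,4) continuous_on_cutoff der(2,3) line_derivative_cutoff
              line_derivative_cutoff' cutoff_outside_cbox s R; simp)+
      qed
      also have "\<dots> = integral (Q R) (\<lambda>y. \<Sum>i\<in>UNIV. u y s * cutoff'' R (axis i 1) y)"
        by (intro integral_sum[symmetric] int u_slice s continuous_on_cutoff) simp
      \<comment> \<open>Since \<open>u\<close> is nonnegative, the one-sided bound on the Laplacian
        of the cutoff can be inserted.\<close>
      also have "\<dots> \<le> integral (Q R) (\<lambda>y. u y s * (24 / R\<^sup>2))"
      proof (rule integral_le)
        show "(\<lambda>y. \<Sum>i\<in>UNIV. u y s * cutoff'' R (axis i 1) y) integrable_on Q R"
          by (intro integrable_sum int u_slice s continuous_on_cutoff) simp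
        show "(\<Sum>i\<in>UNIV. u y s * cutoff'' R (axis i 1) y) \<le> u y s * (24 / R\<^sup>2)" for y
          unfolding sum_distrib_left[symmetric]
          by (intro mult_left_mono laplacian_cutoff_le nonneg R s)
      qed (intro int u_slice s continuous_intros)
      also have "\<dots> = 24 / R\<^sup>2 * integral (Q R) (\<lambda>y. u y s)" by simp
      also have "\<dots> \<le> K"
        unfolding K_def Q_def
        using order_trans[OF m(1)[OF s] m(2)[OF s]] by (intro mult_left_mono) auto
      finally show ?thesis .
    qed
    \<comment> \<open>The growth is integrated from a positive time \<open>s\<close>, because no
      regularity is available at time 0; the limit \<open>s\<close> to 0 follows.\<close>
    have F_upper: "F R \<tau> \<le> m s + (\<tau> - s) * K" if s: "0 < s" "s < \<tau>" for s
    proof -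
      have "F R \<tau> - \<tau> * K \<le> F R s - s * K"
      proof (rule DERIV_nonpos_imp_nonincreasing[where f = "\<lambda>x. F R x - x * K"])
        fix x assume x: "s \<le> x" "x \<le> \<tau>"
        have "((\<lambda>x. F R x - x * K) has_real_derivative
            integral (Q R) (\<lambda>y. ut y x * cutoff R y) - K) (at x)"
          using F_deriv[of x] x s by (auto intro!: derivative_eq_intros)
        then show "\<exists>z. ((\<lambda>x. F R x - x * K) has_real_derivative z) (at x) \<and> z \<le> 0"
          using deriv_le[of x] x s by (intro exI conjI) auto
      qed (use s in simp)
      moreover have "F R s \<le> integral (Q R) (\<lambda>y. u y s)"
        unfolding F_def Q_def
        using s by (intro integral_le integrable_continuous continuous_intros u_slice
            continuous_on_cutoff mult_left_le cutoff_bounds nonneg) auto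
      moreover have "integral (Q R) (\<lambda>y. u y s) \<le> m s"
        unfolding Q_def using s by (intro m(1)) auto
      ultimately show ?thesis by (simp add: algebra_simps)
    qed
    have "F R \<tau> \<le> 0 + (\<tau> - 0) * K"
    proof (rule tendsto_lowerbound)
      show "((\<lambda>s. m s + (\<tau> - s) * K) \<longlongrightarrow> 0 + (\<tau> - 0) * K) (at_right 0)"
        by (intro tendsto_intros m(3))
      show "eventually (\<lambda>s. F R \<tau> \<le> m s + (\<tau> - s) * K) (at_right 0)"
        unfolding eventually_at_right_field using F_upper \<open>0 < \<tau>\<close> by blast
    qed simp
    then show ?thesis by (simp add: K_def)
  qed
  show ?thesis
  proof (rule ccontr)
    assume "u y \<tau> \<noteq> 0"
    with nonneg[OF \<open>0 < \<tau>\<close>, of y] have pos: "0 < u y \<tau>" by (simp add: order_le_less)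
    \<comment> \<open>A positive value persists on a small box: there \<open>u\<close> exceeds half
      of it, and the cutoff is at least 1 / 8 for large \<open>R\<close>. The resulting lower bound
      on \<open>F R \<tau>\<close> does not depend on \<open>R\<close>, against the decay in
      \<open>F_le\<close>.\<close>
    define c where "c = u y \<tau> / 2"
    have "open ((\<lambda>y. u y \<tau>) -` {c<..})"
      by (intro open_vimage u_slice \<open>0 < \<tau>\<close>) simp
    moreover have "y \<in> (\<lambda>y. u y \<tau>) -` {c<..}" using pos by (simp add: c_def)
    ultimately obtain a b where ab: "cbox a b \<subseteq> (\<lambda>y. u y \<tau>) -` {c<..}" "y \<in> box a b"
      by (rule open_contains_cbox)
    define \<kappa> where "\<kappa> = measure lborel (cbox a b) * (c / 8)"
    have "0 < \<kappa>"
      using ab(2) pos by (auto simp: \<kappa>_def c_def content_pos_lt_eq mem_box intro!: mult_pos_pos)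
        (meson order_less_trans)
    obtain N where N: "\<And>z. z \<in> cbox a b \<Longrightarrow> norm z \<le> N"
      using bounded_cbox[of a b] unfolding bounded_iff by blast
    have lower: "\<kappa> \<le> F R \<tau>" if R: "0 < R" "2 * N \<le> R" for R
    proof -
      have cb: "c / 8 \<le> u z \<tau> * cutoff R z" if z: "z \<in> cbox a b" for z
      proof -
        have "c * (1 / 8) \<le> u z \<tau> * cutoff R z"
          using ab(1) z N[OF z] R pos
          by (intro mult_mono cutoff_ge) (auto simp: c_def intro: nonneg \<open>0 < \<tau>\<close>)
        then show ?thesis by simp
      qed
      \<comment> \<open>By \<open>cb\<close> the cutoff is nonzero on \<open>cbox a b\<close>, so
        this box lies inside \<open>Q R\<close>.\<close>
      have sub: "cbox a b \<subseteq> Q R"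
      proof
        fix z assume "z \<in> cbox a b"
        show "z \<in> Q R"
        proof (rule ccontr)
          assume "z \<notin> Q R"
          then have "cutoff R z = 0" unfolding Q_def by (intro cutoff_outside_cbox R)
          with cb[OF \<open>z \<in> cbox a b\<close>] pos show False by (simp add: c_def)
        qed
      qed
      have int: "(\<lambda>z. u z \<tau> * cutoff R z) integrable_on cbox p q" for p q
        by (intro integrable_continuous continuous_intros u_slice \<open>0 < \<tau>\<close> continuous_on_cutoff)
      have "\<kappa> = integral (cbox a b) (\<lambda>_. c / 8)" by (simp add: \<kappa>_def)
      also have "\<dots> \<le> integral (cbox a b) (\<lambda>z. u z \<tau> * cutoff R z)"
        by (intro integral_le int cb) auto
      also have "\<dots> \<le> F R \<tau>"
        unfolding F_def using sub int
        by (intro integral_subset_le) (auto simp: Q_def nonneg \<open>0 < \<tau>\<close> cutoff_bounds)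
      finally show ?thesis .
    qed
    have "\<kappa> \<le> 0"
    proof (rule tendsto_lowerbound)
      have "((\<lambda>R. \<tau> * (24 / R\<^sup>2 * M)) \<longlongrightarrow> \<tau> * (0 * M)) at_top"
        by (intro tendsto_intros tendsto_divide_0[OF tendsto_const] filterlim_at_top_imp_at_infinity
            filterlim_pow_at_top filterlim_ident) simp
      then show "((\<lambda>R. \<tau> * (24 / R\<^sup>2 * M)) \<longlongrightarrow> 0) at_top" by simp
      show "eventually (\<lambda>R. \<kappa> \<le> \<tau> * (24 / R\<^sup>2 * M)) at_top"
        using eventually_ge_at_top[of "2 * N"] eventually_gt_at_top[of 0]
        by eventually_elim (use lower F_le order_trans in blast)
    qed simp
    with \<open>0 < \<kappa>\<close> show False by simp
  qed
qed

section \<open>Nonnegativity on the moving domain\<close>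

lemma line_derivative_frechet:
  fixes f :: "'a::real_normed_vector \<Rightarrow> real"
  assumes "f differentiable (at x)"
  shows "((\<lambda>h. f (x + h *\<^sub>R e)) has_real_derivative frechet_derivative f (at x) e) (at 0)"
proof -
  have f: "(f has_derivative frechet_derivative f (at x)) (at x)"
    using assms by (simp add: frechet_derivative_works)
  have "((\<lambda>h. x + h *\<^sub>R e) has_derivative (\<lambda>h. h *\<^sub>R e)) (at 0)"
    by (auto intro!: derivative_eq_intros)
  then have "((\<lambda>h. f (x + h *\<^sub>R e)) has_derivative (\<lambda>h. frechet_derivative f (at x) (h *\<^sub>R e))) (at 0)"
    by (rule has_derivative_compose) (simp add: f)
  then show ?thesis
    using linear_cmul[OF has_derivative_linear[OF f]]
    by (intro has_derivative_imp_has_field_derivative) (auto simp: mult.commute)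
qed

text \<open>Two unfoldings of \<open>C_k\<close>, each specialised to a coordinate direction.
  Continuity of \<open>f\<close> and of its first derivatives is not stated in
  \<open>C_k 2 f S\<close> and follows from differentiability.\<close>

lemma
  assumes "C_k 2 f S"
  shows line_derivative_C_2: "x \<in> S \<Longrightarrow>
      ((\<lambda>h. f (x + h *\<^sub>R axis i 1)) has_real_derivative partial_deriv i f x) (at 0)"
    and line_derivative_partial_deriv_C_2: "x \<in> S \<Longrightarrow>
      ((\<lambda>h. partial_deriv i f (x + h *\<^sub>R axis i 1)) has_real_derivative
        partial_deriv i (partial_deriv i f) x) (at 0)"
    and continuous_on_C_2: "continuous_on S f"
    and continuous_on_partial_deriv_C_2: "continuous_on S (partial_deriv i f)"
    and continuous_on_partial_deriv_partial_deriv_C_2: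
      "continuous_on S (partial_deriv i (partial_deriv i f))"
proof -
  have eq: "partial_deriv i f = (\<lambda>x. frechet_derivative f (at x) (axis i 1))" for i f
    by (simp add: partial_deriv_def fun_eq_iff)
  have 1: "\<And>x. x \<in> S \<Longrightarrow> f differentiable (at x)"
    and "C_k (Suc 0) (partial_deriv i f) S"
    using assms by (auto simp: numeral_2_eq_2 eq)
  then have 2: "\<And>x. x \<in> S \<Longrightarrow> partial_deriv i f differentiable (at x)"
    and 3: "continuous_on S (partial_deriv i (partial_deriv i f))"
    by (simp_all add: eq[of i "partial_deriv i f"])
  show "continuous_on S (partial_deriv i (partial_deriv i f))" by (fact 3)
  show "continuous_on S f" "continuous_on S (partial_deriv i f)"
    using 1 2 by (auto intro!: continuous_at_imp_continuous_on differentiable_imp_continuous_within)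
  assume "x \<in> S"
  show "((\<lambda>h. f (x + h *\<^sub>R axis i 1)) has_real_derivative partial_deriv i f x) (at 0)"
    unfolding eq[of i f] using \<open>x \<in> S\<close> by (intro line_derivative_frechet 1)
  show "((\<lambda>h. partial_deriv i f (x + h *\<^sub>R axis i 1)) has_real_derivative
        partial_deriv i (partial_deriv i f) x) (at 0)"
    unfolding eq[of i "partial_deriv i f"] using \<open>x \<in> S\<close> by (intro line_derivative_frechet 2)
qed

section \<open>L2 estimates on a varying domain\<close>

lemma integrable_square_diff:
  fixes f g :: "'a \<Rightarrow> real"
  assumes "f \<in> borel_measurable M" "g \<in> borel_measurable M"
    and "integrable M (\<lambda>x. (f x)\<^sup>2)" "integrable M (\<lambda>x. (g x)\<^sup>2)"
  shows "integrable M (\<lambda>x. (f x - g x)\<^sup>2)"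
proof (rule Bochner_Integration.integrable_bound)
  show "integrable M (\<lambda>x. 2 * (f x)\<^sup>2 + 2 * (g x)\<^sup>2)" using assms by simp
  have "(p - q)\<^sup>2 \<le> 2 * p\<^sup>2 + 2 * q\<^sup>2" for p q :: real
    using zero_le_power2[of "p + q"] by (simp add: power2_diff power2_sum)
  then show "AE x in M. norm ((f x - g x)\<^sup>2) \<le> norm (2 * (f x)\<^sup>2 + 2 * (g x)\<^sup>2)"
    by (auto intro!: AE_I2)
qed (use assms in measurable)

lemma in_L2_indicator:
  fixes f :: "'a::euclidean_space \<Rightarrow> real"
  assumes "in_L2 S f" "S \<in> sets lebesgue"
  shows "(\<lambda>x. indicator S x * f x) \<in> borel_measurable lebesgue"
    and "integrable lebesgue (\<lambda>x. (indicator S x * f x)\<^sup>2)"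
proof -
  have *: "S \<inter> space lebesgue \<in> sets lebesgue" using assms(2) by simp
  show "(\<lambda>x. indicator S x * f x) \<in> borel_measurable lebesgue"
    using assms(1) unfolding in_L2_def borel_measurable_restrict_space_iff[OF *] by simp
  have "(indicator S x * f x)\<^sup>2 = indicator S x *\<^sub>R (f x)\<^sup>2" for x
    by (simp add: indicator_def)
  then show "integrable lebesgue (\<lambda>x. (indicator S x * f x)\<^sup>2)"
    using assms(1) unfolding in_L2_def integrable_restrict_space[OF *] by simp
qed

text \<open>Continuity at \<open>s\<close> together with
  \<open>d t 0 \<le> 2 * d t s + 2 * d s 0\<close> bounds the distance to time 0 near every
  \<open>s\<close>. Bisection of \<open>{0..\<tau>}\<close> turns local boundedness into global
  boundedness.\<close>

lemma continuous_L2_bounded: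
  assumes D: "\<And>t. D t \<in> sets lebesgue" and u: "continuous_L2 D u" and "0 \<le> \<tau>"
  obtains M where "\<And>t. 0 \<le> t \<Longrightarrow> t \<le> \<tau> \<Longrightarrow>
    (\<integral>y. (indicator (D t) y * u t y - indicator (D 0) y * u 0 y)\<^sup>2 \<partial>lebesgue) \<le> M"
proof -
  define f where "f t y = indicator (D t) y * u t y" for t y
  define d where "d t s = (\<integral>y. (f t y - f s y)\<^sup>2 \<partial>lebesgue)" for t s
  have int: "integrable lebesgue (\<lambda>y. (f t y - f s y)\<^sup>2)" if "0 \<le> t" "0 \<le> s" for t s
    using u that unfolding continuous_L2_def f_def
    by (intro integrable_square_diff in_L2_indicator D) auto
  have tri: "d t 0 \<le> 2 * d t s + 2 * d s 0" if "0 \<le> t" "0 \<le> s" for t s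
  proof -
    have "(p - r)\<^sup>2 \<le> 2 * (p - q)\<^sup>2 + 2 * (q - r)\<^sup>2" for p q r :: real
      using zero_le_power2[of "(p - q) - (q - r)"] by (simp add: power2_eq_square algebra_simps)
    then have "d t 0 \<le> (\<integral>y. 2 * (f t y - f s y)\<^sup>2 + 2 * (f s y - f 0 y)\<^sup>2 \<partial>lebesgue)"
      unfolding d_def using that by (intro integral_mono int) (auto intro!: int)
    also have "\<dots> = 2 * d t s + 2 * d s 0"
      unfolding d_def using that int by (subst Bochner_Integration.integral_add) auto
    finally show ?thesis .
  qed
  \<comment> \<open>The premise \<open>0 \<le> a\<close> makes \<open>P\<close> vacuous for
    intervals that reach into negative times.\<close>
  define P where "P a b \<longleftrightarrow> (0 \<le> a \<longrightarrow> (\<exists>M. \<forall>t. a \<le> t \<and> t \<le> b \<longrightarrow> d t 0 \<le> M))" for a b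
  have "P 0 \<tau>"
  proof (rule Bolzano[of 0 \<tau> P])
    fix a b c :: real
    assume "P a b" "P b c" "a \<le> b" "b \<le> c"
    show "P a c"
      unfolding P_def
    proof
      assume "0 \<le> a"
      obtain M1 where M1: "\<And>t. a \<le> t \<Longrightarrow> t \<le> b \<Longrightarrow> d t 0 \<le> M1"
        using \<open>P a b\<close> \<open>0 \<le> a\<close> unfolding P_def by blast
      obtain M2 where M2: "\<And>t. b \<le> t \<Longrightarrow> t \<le> c \<Longrightarrow> d t 0 \<le> M2"
        using \<open>P b c\<close> \<open>0 \<le> a\<close> \<open>a \<le> b\<close> unfolding P_def by auto
      have "d t 0 \<le> max M1 M2" if "a \<le> t" "t \<le> c" for t
        using that M1[of t] M2[of t] by linarith
      then show "\<exists>M. \<forall>t. a \<le> t \<and> t \<le> c \<longrightarrow> d t 0 \<le> M" by blast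
    qed
  next
    fix s :: real assume "0 \<le> s"
    then have "((\<lambda>t. d t s) \<longlongrightarrow> 0) (at s within {0..})"
      using u unfolding continuous_L2_def d_def f_def by blast
    then have "eventually (\<lambda>t. dist (d t s) 0 < 1) (at s within {0..})"
      by (rule tendstoD) simp
    then obtain \<delta> where \<delta>: "0 < \<delta>" "\<And>t. 0 \<le> t \<Longrightarrow> t \<noteq> s \<Longrightarrow> dist t s < \<delta> \<Longrightarrow> dist (d t s) 0 < 1"
      unfolding eventually_at by auto
    have near: "d t 0 \<le> 2 + 2 * d s 0" if "0 \<le> t" "\<bar>t - s\<bar> < \<delta>" for t
    proof -
      \<comment> \<open>The punctured filter gives nothing at \<open>t = s\<close>, where the
        distance is 0 anyway.\<close>
      have "d t s \<le> 1"
      proof (cases "t = s")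
        case True
        then show ?thesis by (simp add: d_def)
      next
        case False
        then show ?thesis using \<delta>(2)[of t] that by (simp add: dist_real_def)
      qed
      then show ?thesis using tri[of t s] that \<open>0 \<le> s\<close> by linarith
    qed
    have "P a b" if "a \<le> s" "s \<le> b" "b - a < \<delta>" for a b
      unfolding P_def
    proof (intro impI exI allI)
      fix t assume "0 \<le> a" "a \<le> t \<and> t \<le> b"
      with that show "d t 0 \<le> 2 + 2 * d s 0" by (intro near) auto
    qed
    then show "\<exists>\<delta>>0. \<forall>a b. a \<le> s \<and> s \<le> b \<and> b - a < \<delta> \<longrightarrow> P a b"
      using \<delta>(1) by blast
  qed fact
  then show ?thesis using that unfolding P_def d_def f_def by auto
qed

text \<open>The geometry enters through two properties of the space-time set: it is open, and its
  limit points at time \<open>t\<close> lie in the closure of the slice at time \<open>t\<close>, so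
  that the boundary condition controls them.\<close>

lemma heat_solution_nonneg:
  fixes D :: "real \<Rightarrow> (real^'n) set"
  assumes D: "open {(y, t). y \<in> D t}"
      "\<And>y t. (y, t) \<in> closure {(y, t). y \<in> D t} \<Longrightarrow> y \<in> closure (D t)"
    and T: "heat_solution D a T\<^sub>0 T"
    and T\<^sub>0: "AE y in lebesgue_on (D 0). 0 \<le> T\<^sub>0 y"
    and a: "\<And>t y. 0 < t \<Longrightarrow> t \<le> \<tau> \<Longrightarrow> y \<in> D t \<Longrightarrow> - K \<le> a y t"
    and "0 \<le> K" "0 < \<tau>" and y: "y \<in> D \<tau>"
  shows "0 \<le> T y \<tau>"
proof -
  have T_cont: "continuous_on {(y, t). 0 < t \<and> y \<in> closure (D t)} (\<lambda>(y, t). T y t)"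
    and T_C2: "\<And>t. 0 < t \<Longrightarrow> C_k 2 (\<lambda>y. T y t) (D t)"
    and T_diff: "\<And>t y. 0 < t \<Longrightarrow> y \<in> D t \<Longrightarrow> (\<lambda>s. T y s) differentiable (at t)"
    and Tt_cont: "continuous_on {(y, t). 0 < t \<and> y \<in> D t} (\<lambda>(y, t). deriv (\<lambda>s. T y s) t)"
    and eqn: "\<And>t y. 0 < t \<Longrightarrow> y \<in> D t \<Longrightarrow>
      deriv (\<lambda>s. T y s) t - laplacian (\<lambda>z. T z t) y + a y t * T y t = 0"
    and T_bdry: "\<And>t y. 0 < t \<Longrightarrow> y \<in> frontier (D t) \<Longrightarrow> T y t = 0"
    and T_L2: "continuous_L2 D (\<lambda>t y. T y t)"
    and T_init: "AE y in lebesgue_on (D 0). T y 0 = T\<^sub>0 y"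
    using T unfolding heat_solution_def by auto
  have open_slice: "open (D t)" for t
  proof -
    have "open ((\<lambda>y. (y, t)) -` {(y, t). y \<in> D t})"
      by (intro open_vimage D(1) continuous_intros)
    then show ?thesis by (simp add: vimage_def)
  qed
  have leb: "D t \<in> sets lebesgue" for t
    using open_slice[of t] by simp
  define Pos :: "((real^'n) \<times> real) set" where "Pos = {(y, t). 0 < t}"
  define G where "G = {(y, t). 0 < t \<and> y \<in> D t}"
  define C where "C = {(y, t). 0 < t \<and> y \<in> closure (D t)}"
  have "Pos = snd -` {0<..}" by (auto simp: Pos_def)
  then have open_Pos: "open Pos" by (simp add: open_vimage_snd)
  have "G = Pos \<inter> {(y, t). y \<in> D t}" by (auto simp: Pos_def G_def)
  then have open_G: "open G" using open_Int[OF open_Pos D(1)] by simp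
  have GC: "G \<subseteq> C" using closure_subset by (auto simp: G_def C_def)

  \<comment> \<open>The sign turns the claim into an upper bound, and the factor
    \<open>exp (- K * t)\<close> replaces the coefficient \<open>a\<close> by \<open>a + K\<close>,
    which is nonnegative up to time \<open>\<tau>\<close>. The functions that follow are the
    derivatives of \<open>w\<close>.\<close>
  define w where "w = (\<lambda>(y, t). - exp (- K * t) * T y t)"
  define wt where "wt = (\<lambda>(y, t). - exp (- K * t) * (deriv (\<lambda>s. T y s) t - K * T y t))"
  define wi where "wi i = (\<lambda>(y, t). - exp (- K * t) * partial_deriv i (\<lambda>z. T z t) y)" for i
  define wii where
    "wii i = (\<lambda>(y, t). - exp (- K * t) * partial_deriv i (partial_deriv i (\<lambda>z. T z t)) y)" for i
  have w_cont: "continuous_on C w"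
    using T_cont unfolding w_def C_def case_prod_unfold by (intro continuous_intros)
  have wt_cont: "continuous_on G wt"
  proof -
    have "continuous_on C (\<lambda>p. T (fst p) (snd p))"
      using T_cont by (simp add: C_def case_prod_unfold)
    then have "continuous_on G (\<lambda>p. T (fst p) (snd p))"
      using GC by (rule continuous_on_subset)
    moreover have "continuous_on G (\<lambda>p. deriv (\<lambda>s. T (fst p) s) (snd p))"
      using Tt_cont by (simp add: G_def case_prod_unfold)
    ultimately show ?thesis
      unfolding wt_def case_prod_unfold by (intro continuous_intros)
  qed
  have w_dt: "((\<lambda>s. w (y, s)) has_real_derivative wt (y, t)) (at t)" if "(y, t) \<in> G" for y t
  proof -
    have "((\<lambda>s. T y s) has_real_derivative deriv (\<lambda>s. T y s) t) (at t)"
      using T_diff that by (auto simp: DERIV_deriv_iff_real_differentiable G_def)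
    then show ?thesis
      unfolding w_def wt_def by (auto intro!: derivative_eq_intros simp: algebra_simps)
  qed
  have w_di: "((\<lambda>h. w (y + h *\<^sub>R axis i 1, t)) has_real_derivative wi i (y, t)) (at 0)"
    and w_dii: "((\<lambda>h. wi i (y + h *\<^sub>R axis i 1, t)) has_real_derivative wii i (y, t)) (at 0)"
    if "(y, t) \<in> G" for y t i
    using that unfolding w_def wi_def wii_def case_prod_conv
    by (intro DERIV_cmult line_derivative_C_2[OF T_C2] line_derivative_partial_deriv_C_2[OF T_C2];
        simp add: G_def)+
  \<comment> \<open>By the equation, the time derivative of \<open>T\<close> minus
    \<open>K * T\<close> is the Laplacian of \<open>T\<close> minus \<open>(a + K) * T\<close>;
    where \<open>w\<close> is positive, \<open>T\<close> is negative and the last term has a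
    sign.\<close>
  have w_sub: "wt (y, t) \<le> (\<Sum>i\<in>UNIV. wii i (y, t))"
    if "(y, t) \<in> G" "t \<le> \<tau>" "0 < w (y, t)" for y t
  proof -
    have "T y t < 0" using that(3) by (simp add: w_def mult_less_0_iff)
    moreover have "0 \<le> a y t + K" using a[of t y] that by (auto simp: G_def)
    ultimately have "(a y t + K) * T y t \<le> 0" by (simp add: mult_le_0_iff)
    then have "laplacian (\<lambda>z. T z t) y \<le> deriv (\<lambda>s. T y s) t - K * T y t"
      using eqn[of t y] that by (simp add: G_def algebra_simps)
    then have "exp (- K * t) * laplacian (\<lambda>z. T z t) y
        \<le> exp (- K * t) * (deriv (\<lambda>s. T y s) t - K * T y t)"
      by (intro mult_left_mono) auto
    then show ?thesis
      by (simp add: wt_def wii_def laplacian_def sum_distrib_left sum_negf)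
  qed

  have w_le: "w (y, \<tau>) \<le> \<epsilon>" if "0 < \<epsilon>" for \<epsilon>
  proof -
    define P where "P = {p \<in> G. \<epsilon> \<le> w p}"
    \<comment> \<open>Where \<open>N\<close> meets \<open>G\<close>, \<open>w\<close> is at most
      \<open>\<epsilon>\<close>, so the truncation and its derivatives vanish; \<open>G\<close> and
      \<open>N\<close> are the two open pieces for the extension by zero.\<close>
    define N where "N = Pos - closure P"
    have open_N: "open N" unfolding N_def using open_Pos by (simp add: open_Diff)
    have below: "w p \<le> \<epsilon>" if "p \<in> G" "p \<in> N" for p
      using that closure_subset[of P] by (force simp: N_def P_def)
    \<comment> \<open>\<open>w\<close> vanishes on the lateral boundary, so \<open>P\<close> is relatively closed in \<open>t > 0\<close>\<close>
    have cover: "Pos \<subseteq> G \<union> N"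
    proof
      fix p assume "p \<in> Pos"
      obtain z t where p: "p = (z, t)" by (cases p)
      have t: "0 < t" using \<open>p \<in> Pos\<close> by (simp add: p Pos_def)
      show "p \<in> G \<union> N"
      proof (rule ccontr)
        assume "p \<notin> G \<union> N"
        then have "p \<in> closure P" "z \<notin> D t" using \<open>p \<in> Pos\<close> t by (auto simp: N_def p G_def)
        have "P \<subseteq> {(y, t). y \<in> D t}" by (auto simp: P_def G_def)
        then have "p \<in> closure {(y, t). y \<in> D t}"
          using \<open>p \<in> closure P\<close> closure_mono by blast
        then have z: "z \<in> closure (D t)" using D(2) by (simp add: p)
        then have "p \<in> C" using t by (simp add: p C_def)
        \<comment> \<open>Continuity of \<open>w\<close> is available on \<open>C\<close> only, so
          the bound \<open>\<epsilon> \<le> w\<close> passes from \<open>P\<close> to its limit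
          \<open>p\<close> by way of a relatively closed set.\<close>
        have "closedin (top_of_set C) (C \<inter> w -` {\<epsilon>..})"
          by (intro continuous_closedin_preimage w_cont) simp
        then obtain S where S: "closed S" "C \<inter> w -` {\<epsilon>..} = C \<inter> S"
          unfolding closedin_closed by blast
        have "P \<subseteq> S" using S(2) GC by (auto simp: P_def)
        then have "p \<in> S" using \<open>p \<in> closure P\<close> S(1) closure_minimal by blast
        then have "\<epsilon> \<le> w p" using \<open>p \<in> C\<close> S(2) by blast
        moreover have "z \<in> frontier (D t)"
          using z \<open>z \<notin> D t\<close> open_slice by (simp add: frontier_def interior_open)
        then have "w p = 0" using T_bdry t by (simp add: w_def p)
        ultimately show False using \<open>0 < \<epsilon>\<close> by simp
      qed
    qed
    \<comment> \<open>The truncation of \<open>w\<close> and, by the chain rule, its derivatives,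
      all extended by zero outside \<open>G\<close>.\<close>
    define u where "u z t = (if (z, t) \<in> G then trunc \<epsilon> (w (z, t)) else 0)" for z t
    define ut where "ut z t = (if (z, t) \<in> G then trunc' \<epsilon> (w (z, t)) * wt (z, t) else 0)" for z t
    define ui where "ui i z t = (if (z, t) \<in> G then trunc' \<epsilon> (w (z, t)) * wi i (z, t) else 0)"
      for i z t
    define uii where "uii i z t = (if (z, t) \<in> G
      then trunc'' \<epsilon> (w (z, t)) * (wi i (z, t))\<^sup>2 + trunc' \<epsilon> (w (z, t)) * wii i (z, t) else 0)"
      for i z t
    define m where "m t =
      (\<integral>y. (indicator (D t) y * T y t - indicator (D 0) y * T y 0)\<^sup>2 \<partial>lebesgue)" for t
    obtain M where M: "\<And>t. 0 \<le> t \<Longrightarrow> t \<le> \<tau> \<Longrightarrow> m t \<le> M"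
      by (rule continuous_L2_bounded[OF leb T_L2 less_imp_le[OF \<open>0 < \<tau>\<close>], folded m_def]) blast
    have w_contG: "continuous_on G w" using w_cont GC by (rule continuous_on_subset)
    \<comment> \<open>Spatial regularity of \<open>T\<close> is given for each fixed time and not
      jointly in time, so the spatial derivatives are treated slice by slice.\<close>
    have slice: "continuous_on UNIV (\<lambda>z. if (z, t) \<in> G then f z else 0)"
      if "0 < t" "continuous_on (D t) f" "\<And>z. (z, t) \<in> G \<Longrightarrow> w (z, t) \<le> \<epsilon> \<Longrightarrow> f z = 0"
      for f :: "real^'n \<Rightarrow> real" and t
    proof -
      have "continuous_on UNIV (\<lambda>z. if z \<in> D t then f z else 0)"
      proof (rule continuous_on_extend_zero[of _ "(\<lambda>z. (z, t)) -` N"])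
        show "open ((\<lambda>z. (z, t)) -` N)" by (intro open_vimage open_N continuous_intros)
        show "UNIV \<subseteq> D t \<union> (\<lambda>z. (z, t)) -` N"
          using cover \<open>0 < t\<close> by (auto simp: Pos_def G_def)
        show "f z = 0" if "z \<in> D t" "z \<in> (\<lambda>z. (z, t)) -` N" for z
          using that \<open>0 < t\<close> by (intro \<open>\<And>z. (z, t) \<in> G \<Longrightarrow> w (z, t) \<le> \<epsilon> \<Longrightarrow> f z = 0\<close> below)
            (auto simp: G_def)
      qed (use that open_slice in auto)
      moreover have "(z, t) \<in> G \<longleftrightarrow> z \<in> D t" for z using \<open>0 < t\<close> by (simp add: G_def)
      ultimately show ?thesis by simp
    qed
    have w_slice: "continuous_on (D t) (\<lambda>z. w (z, t))"
      "continuous_on (D t) (\<lambda>z. wi i (z, t))" "continuous_on (D t) (\<lambda>z. wii i (z, t))"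
      if "0 < t" for t i
      unfolding w_def wi_def wii_def case_prod_conv
      by (intro continuous_intros continuous_on_C_2[OF T_C2] continuous_on_partial_deriv_C_2[OF T_C2]
          continuous_on_partial_deriv_partial_deriv_C_2[OF T_C2] that)+
    have trunc_cont: "continuous_on S (\<lambda>z. trunc \<epsilon> (g z))" "continuous_on S (\<lambda>z. trunc' \<epsilon> (g z))"
      "continuous_on S (\<lambda>z. trunc'' \<epsilon> (g z))" if "continuous_on S g"
      for g and S :: "'z::topological_space set"
      by (rule continuous_on_compose2[OF _ that subset_UNIV];
          rule continuous_on_trunc continuous_on_trunc' continuous_on_trunc'')+
    have "u y \<tau> = 0"
    proof (rule heat_subsolution_eq_0[where ut = ut and ui = ui and uii = uii and m = m and \<tau> = \<tau>])
      have Pos: "UNIV \<times> {0<..} = Pos" by (auto simp: Pos_def)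
      show "continuous_on (UNIV \<times> {0<..}) (\<lambda>(y, t). u y t)"
        unfolding Pos u_def case_prod_unfold prod.collapse
        by (rule continuous_on_extend_zero[OF open_G open_N cover])
          (auto intro!: trunc_cont w_contG trunc_eq_0 below)
      show "continuous_on (UNIV \<times> {0<..}) (\<lambda>(y, t). ut y t)"
        unfolding Pos ut_def case_prod_unfold prod.collapse
        by (rule continuous_on_extend_zero[OF open_G open_N cover])
          (auto intro!: continuous_intros trunc_cont w_contG wt_cont trunc_eq_0 below)
      show "continuous_on UNIV (\<lambda>y. ui i y t)" if "0 < t" for i t
        unfolding ui_def
        by (rule slice) (auto intro!: continuous_intros trunc_cont w_slice that simp: trunc_eq_0)
      show "continuous_on UNIV (\<lambda>y. uii i y t)" if "0 < t" for i t
        unfolding uii_def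
        by (rule slice) (auto intro!: continuous_intros trunc_cont w_slice that simp: trunc_eq_0)
      have chain: "((\<lambda>r. trunc \<epsilon> (g r)) has_real_derivative trunc' \<epsilon> (g x) * g') (at x)"
        "((\<lambda>r. trunc' \<epsilon> (g r)) has_real_derivative trunc'' \<epsilon> (g x) * g') (at x)"
        if "(g has_real_derivative g') (at x)" for g g' x
        by (rule DERIV_chain2[OF _ that]; rule DERIV_trunc DERIV_trunc')+
      show "((\<lambda>s. u z s) has_real_derivative ut z t) (at t)" if "0 < t" for z t
      proof -
        \<comment> \<open>The time derivative is read as the derivative along the space-time
          direction \<open>(0, 1)\<close>; the partial derivatives use \<open>(axis i 1, 0)\<close>
          in the same way.\<close>
        have "((\<lambda>r. if (z, t) + r *\<^sub>R (0, 1) \<in> G then trunc \<epsilon> (w ((z, t) + r *\<^sub>R (0, 1))) else 0)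
          has_real_derivative (if (z, t) \<in> G then trunc' \<epsilon> (w (z, t)) * wt (z, t) else 0)) (at 0)"
        proof (rule line_derivative_extend_zero[OF open_G open_N])
          show "(z, t) \<in> G \<union> N" using cover that by (auto simp: Pos_def)
          assume "(z, t) \<in> G"
          have "((\<lambda>s. trunc \<epsilon> (w (z, s))) has_real_derivative trunc' \<epsilon> (w (z, t)) * wt (z, t)) (at (0 + t))"
            using chain(1)[OF w_dt[OF \<open>(z, t) \<in> G\<close>]] by simp
          then show "((\<lambda>r. trunc \<epsilon> (w ((z, t) + r *\<^sub>R (0, 1)))) has_real_derivative
              trunc' \<epsilon> (w (z, t)) * wt (z, t)) (at 0)"
            unfolding DERIV_shift by (simp add: add.commute)
        qed (auto intro!: trunc_eq_0 below)
        then have "((\<lambda>r. u z (r + t)) has_real_derivative ut z t) (at 0)"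
          by (simp add: u_def ut_def add.commute cong: if_cong)
        then show ?thesis using DERIV_shift[of "u z" _ 0 t] by simp
      qed
      show "((\<lambda>h. u (z + h *\<^sub>R axis i 1) t) has_real_derivative ui i z t) (at 0)"
        if "0 < t" for i z t
      proof -
        have "((\<lambda>r. if (z, t) + r *\<^sub>R (axis i 1, 0) \<in> G
            then trunc \<epsilon> (w ((z, t) + r *\<^sub>R (axis i 1, 0))) else 0) has_real_derivative
            (if (z, t) \<in> G then trunc' \<epsilon> (w (z, t)) * wi i (z, t) else 0)) (at 0)"
        proof (rule line_derivative_extend_zero[OF open_G open_N])
          show "(z, t) \<in> G \<union> N" using cover that by (auto simp: Pos_def)
          assume "(z, t) \<in> G"
          show "((\<lambda>r. trunc \<epsilon> (w ((z, t) + r *\<^sub>R (axis i 1, 0)))) has_real_derivative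
              trunc' \<epsilon> (w (z, t)) * wi i (z, t)) (at 0)"
            using chain(1)[OF w_di[OF \<open>(z, t) \<in> G\<close>, of i]] by simp
        qed (auto intro!: trunc_eq_0 below)
        then show ?thesis by (simp add: u_def ui_def cong: if_cong)
      qed
      show "((\<lambda>h. ui i (z + h *\<^sub>R axis i 1) t) has_real_derivative uii i z t) (at 0)"
        if "0 < t" for i z t
      proof -
        have "((\<lambda>r. if (z, t) + r *\<^sub>R (axis i 1, 0) \<in> G
            then trunc' \<epsilon> (w ((z, t) + r *\<^sub>R (axis i 1, 0))) * wi i ((z, t) + r *\<^sub>R (axis i 1, 0))
            else 0) has_real_derivative
            (if (z, t) \<in> G then trunc'' \<epsilon> (w (z, t)) * (wi i (z, t))\<^sup>2
              + trunc' \<epsilon> (w (z, t)) * wii i (z, t) else 0)) (at 0)"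
        proof (rule line_derivative_extend_zero[OF open_G open_N])
          show "(z, t) \<in> G \<union> N" using cover that by (auto simp: Pos_def)
          assume "(z, t) \<in> G"
          from DERIV_mult[OF chain(2)[OF w_di[OF this, of i]] w_dii[OF this, of i]]
          show "((\<lambda>r. trunc' \<epsilon> (w ((z, t) + r *\<^sub>R (axis i 1, 0))) *
                wi i ((z, t) + r *\<^sub>R (axis i 1, 0))) has_real_derivative
              trunc'' \<epsilon> (w (z, t)) * (wi i (z, t))\<^sup>2 + trunc' \<epsilon> (w (z, t)) * wii i (z, t)) (at 0)"
            by (simp add: power2_eq_square ac_simps)
        qed (auto simp: trunc_eq_0 below)
        then show ?thesis by (simp add: ui_def uii_def cong: if_cong)
      qed
      show "ut z t \<le> (\<Sum>i\<in>UNIV. uii i z t)" if "0 < t" "t \<le> \<tau>" for z t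
      proof (cases "(z, t) \<in> G \<and> \<epsilon> < w (z, t)")
        case True
        then have "trunc' \<epsilon> (w (z, t)) * wt (z, t) \<le> trunc' \<epsilon> (w (z, t)) * (\<Sum>i\<in>UNIV. wii i (z, t))"
          using that \<open>0 < \<epsilon>\<close> by (intro mult_left_mono w_sub trunc'_nonneg) auto
        \<comment> \<open>Convexity of the truncation enters here: the terms with
          \<open>trunc''\<close> are nonnegative.\<close>
        also have "\<dots> \<le> (\<Sum>i\<in>UNIV. trunc'' \<epsilon> (w (z, t)) * (wi i (z, t))\<^sup>2
            + trunc' \<epsilon> (w (z, t)) * wii i (z, t))"
          unfolding sum_distrib_left by (intro sum_mono) (simp add: trunc''_nonneg)
        finally show ?thesis using True by (simp add: ut_def uii_def)
      next
        case False
        then show ?thesis by (auto simp: ut_def uii_def trunc_eq_0)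
      qed
      show "0 \<le> u z t" for z t by (simp add: u_def trunc_nonneg)
      show "integral (cbox b c) (\<lambda>z. u z t) \<le> m t" if t: "0 < t" "t \<le> \<tau>" for b c t
      proof -
        have "continuous_on UNIV (\<lambda>z. u z t)"
          unfolding u_def using t by (intro slice) (auto intro!: trunc_cont w_slice simp: trunc_eq_0)
        then have abs: "set_integrable lebesgue (cbox b c) (\<lambda>z. u z t)"
          by (intro absolutely_integrable_continuous) (auto elim: continuous_on_subset)
        have "AE z in lebesgue. z \<in> D 0 \<longrightarrow> T z 0 = T\<^sub>0 z" "AE z in lebesgue. z \<in> D 0 \<longrightarrow> 0 \<le> T\<^sub>0 z"
          using T_init T\<^sub>0 leb by (auto simp: AE_restrict_space_iff)
        \<comment> \<open>The initial sign is known almost everywhere only, and so is the domination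
          of \<open>u\<close> by the squared difference.\<close>
        then have AE: "AE z in lebesgue. indicator (cbox b c) z *\<^sub>R u z t
            \<le> (indicator (D t) z * T z t - indicator (D 0) z * T z 0)\<^sup>2"
        proof eventually_elim
          case (elim z)
          show ?case
          proof (cases "z \<in> cbox b c \<and> z \<in> D t \<and> \<epsilon> < w (z, t)")
            case True
            have w: "0 < w (z, t)" using True \<open>0 < \<epsilon>\<close> by linarith
            then have "T z t < 0" by (simp add: w_def mult_less_0_iff)
            \<comment> \<open>The exponential factor is at most 1 and \<open>T z 0\<close> is
              nonnegative on \<open>D 0\<close>, so \<open>w\<close> lies below the difference of
              the two extended functions.\<close>
            have "exp (- K * t) \<le> 1" using \<open>0 \<le> K\<close> t by simp
            then have "exp (- K * t) * (- T z t) \<le> 1 * (- T z t)"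
              using \<open>T z t < 0\<close> by (intro mult_right_mono) auto
            then have "w (z, t) \<le> - T z t" by (simp add: w_def)
            also have "\<dots> \<le> indicator (D 0) z * T z 0 - T z t"
              using elim by (simp add: indicator_def)
            finally have "(w (z, t))\<^sup>2 \<le> (indicator (D 0) z * T z 0 - T z t)\<^sup>2"
              using w by (intro power_mono) auto
            moreover have "u z t \<le> (w (z, t))\<^sup>2"
              using trunc_le_square[of \<epsilon> "w (z, t)"] \<open>0 < \<epsilon>\<close> w by (simp add: u_def)
            ultimately show ?thesis using True by (simp add: power2_commute)
          next
            case False
            then have "indicator (cbox b c) z *\<^sub>R u z t = 0"
              by (auto simp: u_def trunc_eq_0 G_def indicator_def)
            then show ?thesis by (simp only: zero_le_power2)
          qed
        qed
        have "integral (cbox b c) (\<lambda>z. u z t) = (\<integral>z. indicator (cbox b c) z *\<^sub>R u z t \<partial>lebesgue)"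
          using set_lebesgue_integral_eq_integral(2)[OF abs] by (simp add: set_lebesgue_integral_def)
        also have "\<dots> \<le> m t"
          unfolding m_def
        proof (rule integral_mono_AE[OF _ _ AE])
          show "integrable lebesgue (\<lambda>z. indicator (cbox b c) z *\<^sub>R u z t)"
            using abs by (simp add: set_integrable_def)
          show "integrable lebesgue
              (\<lambda>z. (indicator (D t) z * T z t - indicator (D 0) z * T z 0)\<^sup>2)"
            using T_L2 t unfolding continuous_L2_def
            by (intro integrable_square_diff in_L2_indicator leb) auto
        qed
        finally show ?thesis .
      qed
      show "(m \<longlongrightarrow> 0) (at_right 0)"
      proof (rule tendsto_within_subset)
        show "(m \<longlongrightarrow> 0) (at 0 within {0..})"
          using T_L2 unfolding continuous_L2_def m_def by auto
      qed auto
      show "m t \<le> M" if "0 < t" "t \<le> \<tau>" for t using M that by simp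
    qed (fact \<open>0 < \<tau>\<close>)
    moreover have "(y, \<tau>) \<in> G" using y \<open>0 < \<tau>\<close> by (simp add: G_def)
    \<comment> \<open>If \<open>w\<close> exceeded \<open>\<epsilon>\<close> at
      \<open>(y, \<tau>)\<close>, the truncation would be positive there.\<close>
    ultimately show ?thesis
      using trunc_pos[of \<epsilon> "w (y, \<tau>)"] by (force simp: u_def)
  qed
  have "w (y, \<tau>) \<le> 0"
  proof (rule field_le_epsilon)
    show "w (y, \<tau>) \<le> 0 + \<epsilon>" if "0 < \<epsilon>" for \<epsilon>
      using w_le[OF that] by simp
  qed
  then show ?thesis by (simp add: w_def zero_le_mult_iff)
qed

text \<open>At time 0 the solution attains its data almost everywhere only, hence the separate
  second conjunct.\<close>

theorem proposition8p1:
  fixes V :: "real^'n \<Rightarrow> real^'n"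
    and \<phi> :: "real \<Rightarrow> real^'n \<Rightarrow> real^'n"
    and \<Omega>\<^sub>0 :: "(real^'n) set"
    and \<Omega> :: "real \<Rightarrow> (real^'n) set"
    and a T :: "real^'n \<Rightarrow> real \<Rightarrow> real"
    and T\<^sub>0 :: "real^'n \<Rightarrow> real"
    and \<alpha> :: "real \<Rightarrow> real"
  assumes "smooth_domain \<Omega>\<^sub>0"
    and "smooth_on UNIV V"
    and "flow_of V \<phi>"
    and "\<And>t. \<Omega> t = moving_domain \<phi> \<Omega>\<^sub>0 t"
    and "continuous_on {(y, t). 0 \<le> t \<and> y \<in> \<Omega> t} (\<lambda>(y, t). a y t)"
    and "heat_solution \<Omega> a T\<^sub>0 T"
    and "in_L2 \<Omega>\<^sub>0 T\<^sub>0"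
    and "AE x in lebesgue_on \<Omega>\<^sub>0. 0 \<le> T\<^sub>0 x"
    and "smooth_on UNIV \<alpha>"
    and "\<And>t y. 0 \<le> t \<Longrightarrow> y \<in> \<Omega> t \<Longrightarrow> \<alpha> t \<le> a y t"
  shows "(\<forall>t>0. \<forall>y\<in>\<Omega> t. 0 \<le> T y t) \<and> (AE y in lebesgue_on (\<Omega> 0). 0 \<le> T y 0)"
proof (intro conjI allI impI ballI)
  have V: "C_k (Suc 0) V UNIV" using assms(2) unfolding smooth_on_def by blast
  have "open \<Omega>\<^sub>0" using assms(1) by (simp add: smooth_domain_def)
  note top = open_space_time_moving_domain[OF V assms(3) \<open>open \<Omega>\<^sub>0\<close>, folded assms(4)]
    closure_space_time_moving_domain[OF V assms(3) \<open>open \<Omega>\<^sub>0\<close>, folded assms(4)]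
  have \<Omega>0: "\<Omega> 0 = \<Omega>\<^sub>0"
    using moving_domain_0[OF V assms(3) \<open>open \<Omega>\<^sub>0\<close>] assms(4) by simp
  show "AE y in lebesgue_on (\<Omega> 0). 0 \<le> T y 0"
    using assms(6,8) unfolding heat_solution_def \<Omega>0 by auto
  fix \<tau> :: real and y assume "0 < \<tau>" "y \<in> \<Omega> \<tau>"
  have "C_k 0 \<alpha> UNIV" using assms(9) unfolding smooth_on_def by blast
  \<comment> \<open>The constant \<open>K\<close> depends on the final time: \<open>\<alpha>\<close>
    is bounded on the compact interval \<open>{0..\<tau>}\<close>, but possibly not on the
    half-line.\<close>
  then have "bounded (\<alpha> ` {0..\<tau>})"
    by (intro compact_imp_bounded compact_continuous_image) (auto elim: continuous_on_subset)
  then obtain K where K: "0 < K" "\<And>t. t \<in> {0..\<tau>} \<Longrightarrow> norm (\<alpha> t) \<le> K"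
    unfolding bounded_pos by auto
  show "0 \<le> T y \<tau>"
  proof (rule heat_solution_nonneg[OF top assms(6)])
    show "- K \<le> a z t" if "0 < t" "t \<le> \<tau>" "z \<in> \<Omega> t" for t z
      using K(2)[of t] assms(10)[of t z] that by auto
    show "AE y in lebesgue_on (\<Omega> 0). 0 \<le> T\<^sub>0 y" unfolding \<Omega>0 by (fact assms(8))
  qed (use K(1) \<open>0 < \<tau>\<close> \<open>y \<in> \<Omega> \<tau>\<close> in auto)
qed

end
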